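(* Let $A$ be a bounded set in a real Banach space $X$. Then $$\operatorname{sm}(A)\le \tfrac12\operatorname{wbs}(A)\le \operatorname{wu}(A)\le 2\operatorname{sm}(A),$$ where $\operatorname{wu}(A)$ denotes the set quantity defined in the context.
   Context: For a bounded sequence $(x_k)$: $\operatorname{ca}(x_k)=\inf_{n}\sup\{\|x_k-x_l\|: k,l\ge n\}$, $\operatorname{cca}(x_k)=\operatorname{ca}(\frac1k\sum_{i=1}^k x_i)$, $\widetilde{\operatorname{cca}}(x_k)=\inf$ of $\operatorname{cca}$ over all subsequences; $\operatorname{wbs}(A)=\sup\{\widetilde{\operatorname{cca}}(x_k): (x_k)\subset A\text{ weakly convergent}\}$. For a sequence $(x_k)$ weakly converging to $x\in X$, $\operatorname{wu}(x_k)$ is the infimum of all $\varepsilon>0$ such that there is $n\in\mathbb N$ with $\#\{k\in\mathbb N: |x^*(x_k-x)|>\varepsilon\}\le n$ for every $x^*\in B_{X^*}$; $\widetilde{\operatorname{wu}}(x_k)=\inf$ of $\operatorname{wu}$ over all subsequences; and for a set, $\operatorname{wu}(A)=\sup\{\widetilde{\operatorname{wu}}(x_k): (x_k)\subset A\text{ weakly convergent}\}$. A bounded sequence $(x_k)$ generates an $\ell_1$-spreading model with $\delta>0$ if $\|\sum_{i\in F}\alpha_i x_i\|\ge\delta\sum_{i\in F}|\alpha_i|$ for every finite $F\subset\mathbb N$ with $\#F\le\min F$ and all real scalars $(\alpha_i)_{i\in F}$. Finally $\operatorname{sm}(A)=\sup\{\delta>0: \exists (x_k)\subset A,\ x_k\to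 x\text{ weakly},\ (x_k-x)\text{ generates an }\ell_1\text{-spreading model with }\delta\}$ (with $\sup\emptyset=0$). *)

theory Defs
  imports "HOL-Analysis.Analysis"
begin

text \<open>Convention: a paper sequence (x_k) indexed by k = 1,2,... is represented by
  an Isabelle sequence x :: nat => 'a with paper x_k = x (k - 1).\<close>

definition weakly_conv :: "(nat \<Rightarrow> 'a::real_normed_vector) \<Rightarrow> 'a \<Rightarrow> bool" where
  "weakly_conv x l \<longleftrightarrow>
     (\<forall>f :: 'a \<Rightarrow> real. bounded_linear f \<longrightarrow> ((\<lambda>k. f (x k)) \<longlonglongrightarrow> f l))"

definition dual_ball :: "('a::real_normed_vector \<Rightarrow> real) set" where
  "dual_ball = {f. bounded_linear f \<and> onorm f \<le> 1}"

definition ca :: "(nat \<Rightarrow> 'a::real_normed_vector) \<Rightarrow> real" where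
  "ca x = (INF n. SUP p \<in> {n..} \<times> {n..}. norm (x (fst p) - x (snd p)))"

definition cca :: "(nat \<Rightarrow> 'a::real_normed_vector) \<Rightarrow> real" where
  "cca x = ca (\<lambda>k. (1 / real (Suc k)) *\<^sub>R (\<Sum>i<Suc k. x i))"

definition cca_tilde :: "(nat \<Rightarrow> 'a::real_normed_vector) \<Rightarrow> real" where
  "cca_tilde x = (INF r \<in> {r. strict_mono r}. cca (x \<circ> r))"

text \<open>Sup over the empty set is taken to be 0 (all quantities are nonnegative).\<close>
definition wbs :: "'a::real_normed_vector set \<Rightarrow> real" where
  "wbs A = Sup (insert 0 {cca_tilde x | x. range x \<subseteq> A \<and> (\<exists>l. weakly_conv x l)})"

definition wu_seq :: "(nat \<Rightarrow> 'a::real_normed_vector) \<Rightarrow> 'a \<Rightarrow> real" where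
  "wu_seq x l = Inf {\<epsilon>. \<epsilon> > 0 \<and> (\<exists>n::nat. \<forall>f \<in> dual_ball.
       finite {k. \<bar>f (x k - l)\<bar> > \<epsilon>} \<and> card {k. \<bar>f (x k - l)\<bar> > \<epsilon>} \<le> n)}"

definition wu_tilde :: "(nat \<Rightarrow> 'a::real_normed_vector) \<Rightarrow> 'a \<Rightarrow> real" where
  "wu_tilde x l = (INF r \<in> {r. strict_mono r}. wu_seq (x \<circ> r) l)"

definition wu :: "'a::real_normed_vector set \<Rightarrow> real" where
  "wu A = Sup (insert 0 {wu_tilde x l | x l. range x \<subseteq> A \<and> weakly_conv x l})"

text \<open>l1-spreading model with constant delta; paper condition #F \<le> min F becomes
  card F \<le> Min F + 1 under the 0-based index shift.\<close>
definition l1_spreading :: "(nat \<Rightarrow> 'a::real_normed_vector) \<Rightarrow> real \<Rightarrow> bool" where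
  "l1_spreading x \<delta> \<longleftrightarrow>
     (\<forall>F \<alpha>. finite F \<and> F \<noteq> {} \<and> card F \<le> Min F + 1 \<longrightarrow>
        norm (\<Sum>i\<in>F. \<alpha> i *\<^sub>R x i) \<ge> \<delta> * (\<Sum>i\<in>F. \<bar>\<alpha> i\<bar>))"

definition sm :: "'a::real_normed_vector set \<Rightarrow> real" where
  "sm A = Sup (insert 0 {\<delta>. \<delta> > 0 \<and> (\<exists>x l. range x \<subseteq> A \<and> weakly_conv x l \<and>
                 l1_spreading (\<lambda>k. x k - l) \<delta>)})"

end

theory Submission
  imports Defs "HOL-Library.Ramsey" "HOL-Library.Diagonal_Subsequence"
begin

text \<open>
  The first inequality compares Cesaro means of very different lengths along a sparse subsequence
  of a sequence generating an \<open>\<ell>\<^sub>1\<close>-spreading model. For the second, a functional in the dual ball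
  exceeds \<open>\<epsilon>\<close> on at most \<open>n\<close> terms, so the norms of the Cesaro means, computed by norming
  functionals, are eventually at most about \<open>\<epsilon>\<close>.

  For the third, let \<open>y\<close> be weakly null such that along every subsequence and for every \<open>n\<close> some
  functional in the dual ball exceeds \<open>c\<close> at \<open>n\<close> terms. Suppose that one coefficient vector \<open>a\<close>
  satisfies \<open>\<parallel>\<Sum>\<^sub>j a\<^sub>j y\<^sub>i\<^sub>j\<parallel> \<le> D\<close> for all increasing \<open>i\<close>. By Mazur's theorem, successive blocks of \<open>y\<close>
  have convex combinations that are small in norm; replacing the terms with negative coefficients by
  them keeps the bound \<open>D\<close>, so a functional that exceeds \<open>c\<close> at the other terms yields
  \<open>c \<Sum>\<^sub>j max a\<^sub>j 0 \<le> D\<close>. The same for \<open>- a\<close> gives \<open>c \<Sum>\<^sub>j \<bar>a\<^sub>j\<bar> \<le> 2 D\<close>. Ramsey's theorem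
  reduces the existence of an \<open>\<ell>\<^sub>1\<close>-spreading subsequence with any constant below \<open>c / 2\<close> to this
  situation.
\<close>

section \<open>The Hahn-Banach theorem\<close>

text \<open>Homogeneity is asked for only as an inequality with \<open>t > 0\<close>, which keeps
  the check short for functionals built as infima; applying it to \<open>t\<close> and to
  \<open>1/t\<close> recovers equality in \<open>sublinear_scale\<close>.\<close>

definition sublinear :: "('a::real_vector \<Rightarrow> real) \<Rightarrow> bool" where
  "sublinear p \<longleftrightarrow> (\<forall>x y. p (x + y) \<le> p x + p y) \<and> (\<forall>t>0. \<forall>x. p (t *\<^sub>R x) \<le> t * p x)"

lemma sublinear_add: "sublinear p \<Longrightarrow> p (x + y) \<le> p x + p y"
  and sublinear_scale_le: "sublinear p \<Longrightarrow> t > 0 \<Longrightarrow> p (t *\<^sub>R x) \<le> t * p x"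
  by (auto simp: sublinear_def)

lemma sublinear_zero:
  assumes "sublinear p" shows "p 0 = 0"
  using sublinear_scale_le[OF assms, of 2 0] sublinear_scale_le[OF assms, of "1/2" 0] by simp

lemma sublinear_scale:
  assumes "sublinear p" "t \<ge> 0" shows "p (t *\<^sub>R x) = t * p x"
proof (cases "t = 0")
  case True then show ?thesis using sublinear_zero[OF assms(1)] by simp
next
  case False
  then have t: "t > 0" using assms(2) by simp
  have "p x \<le> (1/t) * p (t *\<^sub>R x)"
    using sublinear_scale_le[OF assms(1), of "1/t" "t *\<^sub>R x"] t by simp
  then have "t * p x \<le> p (t *\<^sub>R x)" using t by (simp add: field_simps)
  then show ?thesis using sublinear_scale_le[OF assms(1) t, of x] by simp
qed

lemma sublinear_neg_le: "sublinear p \<Longrightarrow> - p (- x) \<le> p x"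
  using sublinear_add[of p x "-x"] sublinear_zero[of p] by simp

lemma sublinear_norm: "sublinear norm"
  by (auto simp: sublinear_def norm_triangle_ineq)

text \<open>The infimum of \<open>p (x + t *\<^sub>R z) - t * d\<close> over
  \<open>t \<ge> 0\<close> and \<open>z \<in> C\<close> works: it is finite because
  \<open>d \<le> p\<close> on \<open>C\<close>, and subadditive because \<open>C\<close> is convex.
  A linear functional below \<open>q\<close> is at least \<open>d\<close> on \<open>C\<close>. Hence
  a singleton \<open>C\<close> serves the Hahn-Banach theorem and a general \<open>C\<close> serves
  separation.\<close>

lemma sublinear_shrink:
  fixes p :: "'a::real_vector \<Rightarrow> real"
  assumes p: "sublinear p" and C: "convex C" "C \<noteq> {}" and d: "\<And>z. z \<in> C \<Longrightarrow> d \<le> p z"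
  obtains q where "sublinear q" "q \<le> p" "\<And>z. z \<in> C \<Longrightarrow> q (- z) \<le> - d"
proof -
  define g where "g x w = p (x + fst w *\<^sub>R snd w) - fst w * d" for x :: 'a and w :: "real \<times> 'a"
  define W where "W = {0::real..} \<times> C"
  define q where "q x = (INF w\<in>W. g x w)" for x
  have W: "W \<noteq> {}" using C by (auto simp: W_def)
  have lb: "- p (- x) \<le> g x w" if "w \<in> W" for x w
  proof -
    from that obtain t z where w: "w = (t, z)" "t \<ge> 0" "z \<in> C" by (auto simp: W_def)
    have "t * d \<le> p (t *\<^sub>R z)" using w d sublinear_scale[OF p, of t z] by (simp add: mult_left_mono)
    also have "\<dots> \<le> p (x + t *\<^sub>R z) + p (- x)" using sublinear_add[OF p, of "x + t *\<^sub>R z" "- x"] by simp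
    finally show ?thesis using w by (simp add: g_def)
  qed
  have bdd: "bdd_below (g x ` W)" for x using lb by (meson bdd_belowI2)
  have le: "q x \<le> g x w" if "w \<in> W" for x w
    unfolding q_def using bdd that by (rule cINF_lower)
  have ge: "m \<le> q x" if "\<And>w. w \<in> W \<Longrightarrow> m \<le> g x w" for m x
    unfolding q_def using W that by (intro cINF_greatest) auto
  have add: "q (x + y) \<le> q x + q y" for x y
  proof -
    have "q (x + y) \<le> g x w + g y v" if "w \<in> W" "v \<in> W" for w v
    proof -
      from that obtain t z s u where w: "w = (t, z)" "t \<ge> 0" "z \<in> C" "v = (s, u)" "s \<ge> 0" "u \<in> C"
        by (auto simp: W_def)
      \<comment> \<open>Two nonnegative multiples of points of \<open>C\<close> merge into one
        multiple of a convex combination; if both factors vanish, any point of \<open>C\<close> will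
        do.\<close>
      obtain r where r: "r \<in> C" "t *\<^sub>R z + s *\<^sub>R u = (t + s) *\<^sub>R r"
      proof (cases "t + s = 0")
        case True
        then have "t = 0" "s = 0" using w by auto
        then show ?thesis using that[of z] w by simp
      next
        case False
        define r where "r = (t/(t+s)) *\<^sub>R z + (s/(t+s)) *\<^sub>R u"
        have "r \<in> C" unfolding r_def using w False C(1)
          by (intro convexD) (auto simp flip: add_divide_distrib)
        moreover have "(t + s) *\<^sub>R r = t *\<^sub>R z + s *\<^sub>R u" using False by (simp add: r_def scaleR_add_right)
        ultimately show ?thesis using that by metis
      qed
      have "q (x + y) \<le> g (x + y) (t + s, r)" by (rule le) (use w r in \<open>auto simp: W_def\<close>)
      also have "\<dots> = p ((x + t *\<^sub>R z) + (y + s *\<^sub>R u)) - (t + s) * d"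
      proof -
        have "(x + t *\<^sub>R z) + (y + s *\<^sub>R u) = x + y + (t *\<^sub>R z + s *\<^sub>R u)" by (simp add: algebra_simps)
        then show ?thesis using r by (simp only: g_def fst_conv snd_conv)
      qed
      also have "\<dots> \<le> g x w + g y v"
        using sublinear_add[OF p, of "x + t *\<^sub>R z" "y + s *\<^sub>R u"] w by (simp add: g_def algebra_simps)
      finally show ?thesis .
    qed
    then have "q (x + y) - g x w \<le> q y" if "w \<in> W" for w using that by (intro ge) (simp add: algebra_simps)
    then have "q (x + y) - q y \<le> q x" by (intro ge) (simp add: algebra_simps)
    then show ?thesis by simp
  qed
  have scale: "q (t *\<^sub>R x) \<le> t * q x" if t: "t > 0" for t x
  proof -
    have "q (t *\<^sub>R x) / t \<le> q x"
    proof (rule ge)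
      fix w assume "w \<in> W"
      then obtain s z where w: "w = (s, z)" "s \<ge> 0" "z \<in> C" by (auto simp: W_def)
      have "q (t *\<^sub>R x) \<le> g (t *\<^sub>R x) (t * s, z)" by (rule le) (use w t in \<open>auto simp: W_def\<close>)
      also have "\<dots> = t * g x w"
        using sublinear_scale[OF p, of t "x + s *\<^sub>R z"] t w by (simp add: g_def scaleR_add_right algebra_simps)
      finally show "q (t *\<^sub>R x) / t \<le> g x w" using t by (simp add: field_simps)
    qed
    then show ?thesis using t by (simp add: field_simps)
  qed
  have "sublinear q" using add scale by (auto simp: sublinear_def)
  moreover have "q \<le> p"
  proof (rule le_funI)
    fix x
    obtain z where "z \<in> C" using C by blast
    then show "q x \<le> p x" using le[of "(0, z)" x] by (simp add: W_def g_def)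
  qed
  moreover have "q (- z) \<le> - d" if "z \<in> C" for z
    using le[of "(1, z)" "- z"] that sublinear_zero[OF p] by (simp add: W_def g_def)
  ultimately show thesis by (rule that)
qed

text \<open>Zorn's lemma: the pointwise infimum of a chain is finite, since
  \<open>q x \<ge> - q (- x) \<ge> - p (- x)\<close>, and it is subadditive, since any two members
  of a chain can be replaced by the smaller one.\<close>

lemma exists_minimal_sublinear:
  fixes p :: "'a::real_vector \<Rightarrow> real"
  assumes p: "sublinear p"
  obtains q where "sublinear q" "q \<le> p" "\<And>r. sublinear r \<Longrightarrow> r \<le> q \<Longrightarrow> r = q"
proof -
  define S where "S = {q. sublinear q \<and> q \<le> p}"
  \<comment> \<open>The order is reversed, so that the maximal element supplied by Zorn's lemma is a
    minimal functional.\<close>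
  define R where "R = (\<lambda>q r :: 'a \<Rightarrow> real. r \<le> q)"
  have "\<exists>m\<in>S. \<forall>q\<in>S. R m q \<longrightarrow> q = m"
  proof (rule predicate_Zorn)
    show "partial_order_on S (relation_of R S)"
      by (rule partial_order_on_relation_ofI) (auto simp: R_def)
    fix K assume K: "K \<in> Chains (relation_of R S)"
    have KS: "K \<subseteq> S" using K by (auto simp: Chains_def relation_of_def)
    have tot: "q \<le> r \<or> r \<le> q" if "q \<in> K" "r \<in> K" for q r
      using K that by (auto simp: Chains_def relation_of_def R_def)
    show "\<exists>u\<in>S. \<forall>q\<in>K. R q u"
    proof (cases "K = {}")
      case True then show ?thesis using p by (auto simp: S_def)
    next
      case False
      define u where "u x = (INF q\<in>K. q x)" for x
      have sub: "sublinear q" "q x \<le> p x" if "q \<in> K" for q x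
        using KS that by (auto simp: S_def le_fun_def)
      have lb: "- p (- x) \<le> q x" if "q \<in> K" for q x
        using sub[OF that] sublinear_neg_le[of q x] by (meson neg_le_iff_le order_trans)
      have le: "u x \<le> q x" if "q \<in> K" for q x
        unfolding u_def using that lb by (intro cINF_lower) (meson bdd_belowI2)
      have ge: "m \<le> u x" if "\<And>q. q \<in> K \<Longrightarrow> m \<le> q x" for m x
        unfolding u_def using False that by (intro cINF_greatest) auto
      have add: "u (x + y) \<le> u x + u y" for x y
      proof -
        have "u (x + y) \<le> q x + r y" if qr: "q \<in> K" "r \<in> K" for q r
        proof -
          obtain m where m: "m \<in> K" "m \<le> q" "m \<le> r" using tot[OF qr] qr by auto
          have "u (x + y) \<le> m (x + y)" using m le by simp
          also have "\<dots> \<le> m x + m y" using sub m sublinear_add by blast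
          also have "\<dots> \<le> q x + r y" using m by (intro add_mono) (auto simp: le_fun_def)
          finally show ?thesis .
        qed
        then have "u (x + y) - q x \<le> u y" if "q \<in> K" for q
          using that by (intro ge) (metis add.commute diff_le_eq)
        then have "u (x + y) - u y \<le> u x" by (intro ge) (simp add: algebra_simps)
        then show ?thesis by simp
      qed
      have scale: "u (t *\<^sub>R x) \<le> t * u x" if t: "t > 0" for t x
      proof -
        have "u (t *\<^sub>R x) / t \<le> u x"
        proof (rule ge)
          fix q assume q: "q \<in> K"
          have "u (t *\<^sub>R x) \<le> t * q x"
            using le[OF q, of "t *\<^sub>R x"] sublinear_scale_le[OF sub(1)[OF q] t, of x] by simp
          then show "u (t *\<^sub>R x) / t \<le> q x" using t by (simp add: field_simps)
        qed
        then show ?thesis using t by (simp add: field_simps)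
      qed
      have "u x \<le> p x" for x using False le sub(2) by (meson all_not_in_conv order_trans)
      then have "u \<in> S" using add scale by (auto simp: S_def sublinear_def le_fun_def)
      then show ?thesis using le by (auto simp: R_def le_fun_def)
    qed
  qed
  then obtain m where m: "m \<in> S" "\<And>q. q \<in> S \<Longrightarrow> q \<le> m \<Longrightarrow> q = m" by (auto simp: R_def)
  show thesis
    by (rule that[of m]) (use m in \<open>auto simp: S_def intro: order_trans\<close>)
qed

text \<open>A minimal sublinear functional is additive: shrinking it along a single vector cannot
  decrease it.\<close>
theorem exists_linear_below_sublinear:
  fixes p :: "'a::real_vector \<Rightarrow> real"
  assumes p: "sublinear p"
  obtains f where "linear f" "\<And>x. f x \<le> p x"
proof -
  obtain q where q: "sublinear q" "q \<le> p" and min: "\<And>r. sublinear r \<Longrightarrow> r \<le> q \<Longrightarrow> r = q"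
    using exists_minimal_sublinear[OF p] by metis
  have neg: "q (- v) = - q v" for v
  proof -
    obtain r where r: "sublinear r" "r \<le> q" "r (- v) \<le> - q v"
      by (rule sublinear_shrink[OF q(1), of "{v}" "q v"]) auto
    then show ?thesis using min[of r] sublinear_neg_le[OF q(1), of "- v"] by simp
  qed
  have add: "q (x + y) = q x + q y" for x y
    using sublinear_add[OF q(1), of x y] sublinear_add[OF q(1), of "x + y" "- y"] neg[of y] by simp
  have scale: "q (t *\<^sub>R x) = t * q x" for t x
    using sublinear_scale[OF q(1), of t x] sublinear_scale[OF q(1), of "- t" x] neg[of "t *\<^sub>R x"]
    by (cases "t \<ge> 0") auto
  have "linear q" by (rule linearI) (auto simp: add scale)
  then show thesis using q(2) by (intro that[of q]) (auto simp: le_fun_def)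
qed

section \<open>Norming functionals, separation of convex sets and Mazur's theorem\<close>

lemma dual_ball_abs_le:
  assumes "f \<in> dual_ball" shows "\<bar>f x\<bar> \<le> norm x"
proof -
  have "\<bar>f x\<bar> \<le> onorm f * norm x" using assms onorm[of f x] by (simp add: dual_ball_def)
  also have "\<dots> \<le> 1 * norm x" using assms by (intro mult_right_mono) (auto simp: dual_ball_def)
  finally show ?thesis by simp
qed

text \<open>Shrinking the norm along \<open>C\<close> and taking a linear functional below the
  result keeps both the norm bound 1 and the exact constant \<open>d\<close>, since
  \<open>f (- z) \<le> q (- z) \<le> - d\<close>. A singleton gives a norming functional, a convex
  hull gives Mazur's theorem.\<close>

lemma dual_ball_separates_convex:
  fixes C :: "'a::real_normed_vector set"
  assumes "convex C" "C \<noteq> {}" "\<And>z. z \<in> C \<Longrightarrow> d \<le> norm z"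
  obtains f where "f \<in> dual_ball" "\<And>z. z \<in> C \<Longrightarrow> d \<le> f z"
proof -
  obtain q :: "'a \<Rightarrow> real" where q: "sublinear q" "q \<le> norm" "\<And>z. z \<in> C \<Longrightarrow> q (- z) \<le> - d"
    using sublinear_shrink[OF sublinear_norm assms] by metis
  obtain f where f: "linear f" "\<And>x. f x \<le> q x" using exists_linear_below_sublinear[OF q(1)] by metis
  have le: "f x \<le> norm x" for x using f(2)[of x] q(2) by (meson le_funD order_trans)
  have abs: "\<bar>f x\<bar> \<le> norm x" for x using le[of x] le[of "-x"] linear_neg[OF f(1), of x] by simp
  have "bounded_linear f"
    using f(1) abs by (intro bounded_linear_intro[where K=1]) (auto simp: linear_add linear_scale)
  moreover have "onorm f \<le> 1" by (rule onorm_bound) (auto simp: abs)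
  ultimately have "f \<in> dual_ball" by (simp add: dual_ball_def)
  moreover have "d \<le> f z" if "z \<in> C" for z
    using f(2)[of "-z"] q(3)[OF that] linear_neg[OF f(1), of z] by simp
  ultimately show thesis by (rule that)
qed

lemma norm_le_if_dual_ball_le:
  fixes v :: "'a::real_normed_vector"
  assumes "\<And>f. f \<in> dual_ball \<Longrightarrow> f v \<le> m"
  shows "norm v \<le> m"
proof -
  obtain f :: "'a \<Rightarrow> real" where "f \<in> dual_ball" "norm v \<le> f v"
    by (rule dual_ball_separates_convex[of "{v}" "norm v"]) auto
  then show ?thesis using assms by force
qed

text \<open>Mazur's theorem: if the hull kept distance \<open>e\<close> from 0, a separating
  functional would stay above \<open>e\<close> along the whole sequence, contrary to weak
  nullness.\<close>

lemma weakly_null_convex_hull: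
  fixes y :: "nat \<Rightarrow> 'a::real_normed_vector"
  assumes y: "weakly_conv y 0" and e: "e > 0"
  obtains u where "u \<in> convex hull (range y)" "norm u < e"
proof -
  have "\<exists>u \<in> convex hull (range y). norm u < e"
  proof (rule ccontr)
    assume "\<not> ?thesis"
    then have "\<And>z. z \<in> convex hull (range y) \<Longrightarrow> e \<le> norm z" by force
    then obtain f where f: "f \<in> dual_ball" "\<And>z. z \<in> convex hull (range y) \<Longrightarrow> e \<le> f z"
      using dual_ball_separates_convex[of "convex hull (range y)" e] by auto
    have bl: "bounded_linear f" using f(1) by (simp add: dual_ball_def)
    then have "(\<lambda>k. f (y k)) \<longlonglongrightarrow> f 0" using y by (simp add: weakly_conv_def)
    moreover have "f 0 = 0" using bl by (simp add: linear_simps)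
    moreover have "e \<le> f (y k)" for k using f(2) by (simp add: hull_inc)
    ultimately have "e \<le> 0" by (metis LIMSEQ_le_const)
    then show False using e by simp
  qed
  then show thesis using that by blast
qed

section \<open>Extraction of spreading models\<close>

lemma weakly_conv_subseq:
  assumes "weakly_conv x l" "strict_mono r" shows "weakly_conv (x \<circ> r) l"
  using assms LIMSEQ_subseq_LIMSEQ[of _ _ r] unfolding weakly_conv_def by (fastforce simp: o_def)

lemma weakly_conv_diff:
  assumes "weakly_conv x l" shows "weakly_conv (\<lambda>k. x k - l) 0"
  unfolding weakly_conv_def
proof (intro allI impI)
  fix f :: "'a \<Rightarrow> real" assume f: "bounded_linear f"
  then have "(\<lambda>k. f (x k) - f l) \<longlonglongrightarrow> f l - f l"
    using assms by (intro tendsto_diff tendsto_const) (auto simp: weakly_conv_def)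
  then show "(\<lambda>k. f (x k - l)) \<longlonglongrightarrow> f 0" using f by (simp add: linear_simps)
qed

text \<open>Mazur's theorem is applied to successive tails; a convex combination involves finitely
  many terms, so an interval of indices captures each one. The intervals are consecutive, so picking
  one index from each of several blocks, taken in order, gives increasing indices.\<close>

lemma weakly_null_convex_blocks:
  fixes y :: "nat \<Rightarrow> 'a::real_normed_vector"
  assumes y: "weakly_conv y 0" and e: "e > 0"
  obtains b u where "strict_mono b" "\<And>k. u k \<in> convex hull (y ` {b k..<b (Suc k)})" "\<And>k. norm (u k) < e"
proof -
  have ex: "\<exists>N>m. \<exists>u \<in> convex hull (y ` {m..<N}). norm u < e" for m
  proof -
    have "weakly_conv (y \<circ> (+) m) 0" using y by (rule weakly_conv_subseq) (simp add: strict_mono_def)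
    then obtain u where u: "u \<in> convex hull (range (y \<circ> (+) m))" "norm u < e"
      using weakly_null_convex_hull[OF _ e] by metis
    obtain S where S: "finite S" "S \<subseteq> range (y \<circ> (+) m)" "u \<in> convex hull S"
      using u(1) unfolding convex_hull_explicit by blast
    obtain T where T: "finite T" "S = (y \<circ> (+) m) ` T" using finite_subset_image[OF S(1,2)] by blast
    obtain k where k: "\<And>t. t \<in> T \<Longrightarrow> t < k" using T(1) by (meson finite_nat_set_iff_bounded)
    have "S \<subseteq> y ` {m..<m + Suc k}" using T(2) k by (fastforce simp: less_Suc_eq)
    then have "u \<in> convex hull (y ` {m..<m + Suc k})" using S(3) hull_mono by blast
    then show ?thesis using u(2) by (intro exI[of _ "m + Suc k"]) auto
  qed
  \<comment> \<open>\<open>True\<close> fills the place that dependent choice reserves for a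
    property of the single value \<open>b k\<close>.\<close>
  have "\<exists>b. \<forall>k. True \<and> (b k < b (Suc k) \<and> (\<exists>u \<in> convex hull (y ` {b k..<b (Suc k)}). norm u < e))"
    using ex by (intro dependent_nat_choice) auto
  then obtain b where b: "\<And>k. b k < b (Suc k)" "\<And>k. \<exists>u \<in> convex hull (y ` {b k..<b (Suc k)}). norm u < e"
    by auto
  then obtain u where "\<And>k. u k \<in> convex hull (y ` {b k..<b (Suc k)}) \<and> norm (u k) < e" by metis
  then show thesis using b(1) that[of b u] by (simp add: strict_mono_Suc_iff)
qed

text \<open>With all other entries fixed, the admissible vectors in one entry form the preimage of a
  ball under an affine map, hence a convex set. So the entries pass to the hulls one at a time; the
  free summand \<open>c\<close> absorbs the entry that is held fixed in the induction.\<close>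

lemma norm_sum_convex_hull_le:
  fixes S :: "'i \<Rightarrow> 'a::real_normed_vector set"
  assumes J: "finite J" and v: "\<And>j. j \<in> J \<Longrightarrow> v j \<in> convex hull (S j)"
    and D: "\<And>w. (\<And>j. j \<in> J \<Longrightarrow> w j \<in> S j) \<Longrightarrow> norm (c + (\<Sum>j\<in>J. a j *\<^sub>R w j)) \<le> D"
  shows "norm (c + (\<Sum>j\<in>J. a j *\<^sub>R v j)) \<le> D"
  using assms
proof (induction J arbitrary: c rule: finite_induct)
  case empty then show ?case by simp
next
  case (insert i J)
  let ?s = "\<Sum>j\<in>J. a j *\<^sub>R v j"
  have "convex {z. norm (c + a i *\<^sub>R z + ?s) \<le> D}"
  proof (rule convexI, clarsimp)
    fix p q s t assume h: "norm (c + a i *\<^sub>R p + ?s) \<le> D" "norm (c + a i *\<^sub>R q + ?s) \<le> D"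
      "0 \<le> s" "0 \<le> t" "s + t = (1::real)"
    have "c + a i *\<^sub>R (s *\<^sub>R p + t *\<^sub>R q) + ?s = (s + t) *\<^sub>R (c + ?s) + a i *\<^sub>R (s *\<^sub>R p + t *\<^sub>R q)"
      using h(5) by simp
    also have "\<dots> = s *\<^sub>R (c + a i *\<^sub>R p + ?s) + t *\<^sub>R (c + a i *\<^sub>R q + ?s)"
      by (simp add: scaleR_add_left scaleR_add_right mult.commute)
    also have "norm \<dots> \<le> s * D + t * D"
      using h by (intro norm_triangle_mono) (auto simp: mult_left_mono)
    also have "\<dots> = D" using h(5) by (simp flip: distrib_right)
    finally show "norm (c + a i *\<^sub>R (s *\<^sub>R p + t *\<^sub>R q) + ?s) \<le> D" .
  qed
  moreover have "S i \<subseteq> {z. norm (c + a i *\<^sub>R z + ?s) \<le> D}"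
  proof clarify
    fix z assume z: "z \<in> S i"
    show "norm (c + a i *\<^sub>R z + ?s) \<le> D"
    proof (rule insert.IH)
      fix w assume w: "\<And>j. j \<in> J \<Longrightarrow> w j \<in> S j"
      have "norm (c + (\<Sum>j\<in>insert i J. a j *\<^sub>R (w(i := z)) j)) \<le> D"
        using w z by (intro insert.prems(2)) auto
      moreover have "(\<Sum>j\<in>J. a j *\<^sub>R (w(i := z)) j) = (\<Sum>j\<in>J. a j *\<^sub>R w j)"
        using insert.hyps(2) by (intro sum.cong) auto
      ultimately show "norm (c + a i *\<^sub>R z + (\<Sum>j\<in>J. a j *\<^sub>R w j)) \<le> D"
        using insert.hyps by (simp add: add.assoc)
    qed (use insert.prems in auto)
  qed
  ultimately have "convex hull (S i) \<subseteq> {z. norm (c + a i *\<^sub>R z + ?s) \<le> D}"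
    by (intro hull_minimal)
  then have "norm (c + a i *\<^sub>R v i + ?s) \<le> D" using insert.prems(1) by blast
  then show ?case using insert.hyps by (simp add: add.assoc)
qed

section \<open>Lower l1-estimates from hereditarily large sequences\<close>

text \<open>One-sided form of the failure of a \<open>wu\<close> bound. All subsequences are
  included so that it can be used along the starting points of blocks that are only chosen
  later.\<close>

definition hereditarily_large :: "(nat \<Rightarrow> 'a::real_normed_vector) \<Rightarrow> real \<Rightarrow> bool" where
  "hereditarily_large y c \<longleftrightarrow> (\<forall>(r::nat \<Rightarrow> nat) n. strict_mono r \<longrightarrow>
     (\<exists>f\<in>dual_ball. \<exists>K. finite K \<and> card K = n \<and> (\<forall>k\<in>K. f (y (r k)) > c)))"

lemma hereditarily_large_subseq:
  assumes "hereditarily_large y c" "strict_mono s" shows "hereditarily_large (y \<circ> s) c"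
  unfolding hereditarily_large_def
proof (intro allI impI)
  fix r :: "nat \<Rightarrow> nat" and n assume "strict_mono r"
  then have "strict_mono (s \<circ> r)" using assms(2) by (simp add: strict_mono_o)
  then show "\<exists>f\<in>dual_ball. \<exists>K. finite K \<and> card K = n \<and> (\<forall>k\<in>K. f ((y \<circ> s) (r k)) > c)"
    using assms(1) unfolding hereditarily_large_def by fastforce
qed

lemma strict_mono_on_nth_sorted_list_of_set:
  "strict_mono_on {..<card K} (\<lambda>j. sorted_list_of_set K ! j)" for K :: "nat set"
  using strict_sorted_list_of_set[of K]
  by (auto simp: strict_mono_on_def sorted_wrt_iff_nth_less)

lemma sum_positive_part_le:
  fixes y :: "nat \<Rightarrow> 'a::real_normed_vector"
  assumes y: "weakly_conv y 0" and large: "hereditarily_large y c"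
    and D: "\<And>i. strict_mono_on {..<n::nat} i \<Longrightarrow> norm (\<Sum>j<n. a j *\<^sub>R y (i j)) \<le> D"
  shows "c * (\<Sum>j<n. max (a j) 0) \<le> D"
proof (rule field_le_epsilon)
  fix e :: real assume e: "e > 0"
  define S where "S = (\<Sum>j<n. \<bar>a j\<bar>)"
  have S: "S \<ge> 0" by (simp add: S_def sum_nonneg)
  \<comment> \<open>The terms with coefficients that are not positive will cost at most
    \<open>\<eta> * S \<le> e\<close>; the added 1 avoids division by zero.\<close>
  define \<eta> where "\<eta> = e / (1 + S)"
  have \<eta>: "\<eta> > 0" using e S by (simp add: \<eta>_def)
  obtain b u where b: "strict_mono b" and u: "\<And>k. u k \<in> convex hull (y ` {b k..<b (Suc k)})" "\<And>k. norm (u k) < \<eta>"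
    using weakly_null_convex_blocks[OF y \<eta>] by metis
  \<comment> \<open>Largeness is used along the block starts \<open>b\<close>, so that a kept term
    \<open>y (b k)\<close> lies in the same block as its substitute \<open>u k\<close>.\<close>
  obtain f K where f: "f \<in> dual_ball" and K: "finite K" "card K = n" "\<And>k. k \<in> K \<Longrightarrow> f (y (b k)) > c"
    using large b unfolding hereditarily_large_def by meson
  define k where "k j = sorted_list_of_set K ! j" for j
  have k: "k i < k j" if "i < j" "j < n" for i j
    using strict_mono_onD[OF strict_mono_on_nth_sorted_list_of_set[of K], of i j] that K by (simp add: k_def)
  have kK: "k j \<in> K" if "j < n" for j
    using that K nth_mem[of j "sorted_list_of_set K"] by (simp add: k_def)
  define v where "v j = (if a j > 0 then y (b (k j)) else u (k j))" for j
  have "norm (0 + (\<Sum>j<n. a j *\<^sub>R v j)) \<le> D"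
  proof (rule norm_sum_convex_hull_le[where S="\<lambda>j. y ` {b (k j)..<b (Suc (k j))}"])
    show "v j \<in> convex hull (y ` {b (k j)..<b (Suc (k j))})" for j
      using u b by (auto simp: v_def strict_mono_Suc_iff intro!: hull_inc)
    fix w assume w: "\<And>j. j \<in> {..<n} \<Longrightarrow> w j \<in> y ` {b (k j)..<b (Suc (k j))}"
    then have "\<forall>j. \<exists>i. j < n \<longrightarrow> b (k j) \<le> i \<and> i < b (Suc (k j)) \<and> w j = y i" by fastforce
    then obtain i where i: "\<And>j. j < n \<Longrightarrow> b (k j) \<le> i j \<and> i j < b (Suc (k j)) \<and> w j = y (i j)" by metis
    \<comment> \<open>Indices from distinct blocks are ordered as the blocks are, so the hypothesis
      \<open>D\<close> applies to every choice.\<close>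
    have "i p < i q" if "p < q" "q < n" for p q
    proof -
      have "b (Suc (k p)) \<le> b (k q)" using k[OF that] b by (simp add: strict_mono_less_eq Suc_le_eq)
      then show ?thesis using i[of p] i[of q] that by simp
    qed
    then have "norm (\<Sum>j<n. a j *\<^sub>R y (i j)) \<le> D" by (intro D) (auto simp: strict_mono_on_def)
    then show "norm (0 + (\<Sum>j<n. a j *\<^sub>R w j)) \<le> D" using i by simp
  qed simp
  then have "f (\<Sum>j<n. a j *\<^sub>R v j) \<le> D" using dual_ball_abs_le[OF f] by (smt (verit) add_0)
  moreover have "f (\<Sum>j<n. a j *\<^sub>R v j) = (\<Sum>j<n. a j * f (v j))"
    using f bounded_linear.linear[of f] by (simp add: dual_ball_def linear_sum linear_scale)
  moreover have "(\<Sum>j<n. c * max (a j) 0 - \<eta> * \<bar>a j\<bar>) \<le> (\<Sum>j<n. a j * f (v j))"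
  proof (rule sum_mono)
    fix j assume "j \<in> {..<n}"
    then have j: "f (y (b (k j))) > c" using kK K by simp
    show "c * max (a j) 0 - \<eta> * \<bar>a j\<bar> \<le> a j * f (v j)"
    proof (cases "a j > 0")
      case True
      have "c * a j \<le> a j * f (v j)" using j True by (simp add: v_def mult.commute)
      moreover have "0 \<le> \<eta> * \<bar>a j\<bar>" using \<eta> by simp
      ultimately have "c * a j - \<eta> * \<bar>a j\<bar> \<le> a j * f (v j)" by linarith
      then show ?thesis using True by (simp add: max_def)
    next
      case False
      have "\<bar>f (v j)\<bar> \<le> \<eta>"
        using dual_ball_abs_le[OF f, of "u (k j)"] u(2)[of "k j"] False by (simp add: v_def)
      then have "\<bar>a j * f (v j)\<bar> \<le> \<bar>a j\<bar> * \<eta>" unfolding abs_mult by (rule mult_left_mono) simp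
      then show ?thesis using False by (simp add: max_def mult.commute)
    qed
  qed
  moreover have "(\<Sum>j<n. c * max (a j) 0 - \<eta> * \<bar>a j\<bar>) = c * (\<Sum>j<n. max (a j) 0) - \<eta> * S"
    by (simp add: S_def sum_subtractf sum_distrib_left)
  moreover have "\<eta> * S \<le> e" using e S by (simp add: \<eta>_def field_simps)
  ultimately show "c * (\<Sum>j<n. max (a j) 0) \<le> D + e" by simp
qed

text \<open>The positive and the negative parts of \<open>a\<close> are each bounded by
  \<open>D\<close>; adding the two bounds produces the factor 2 of
  \<open>wu A \<le> 2 * sm A\<close>.\<close>

lemma sum_abs_le:
  fixes y :: "nat \<Rightarrow> 'a::real_normed_vector"
  assumes y: "weakly_conv y 0" and large: "hereditarily_large y c"
    and D: "\<And>i. strict_mono_on {..<n::nat} i \<Longrightarrow> norm (\<Sum>j<n. a j *\<^sub>R y (i j)) \<le> D"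
  shows "c * (\<Sum>j<n. \<bar>a j\<bar>) \<le> 2 * D"
proof -
  have "c * (\<Sum>j<n. max (a j) 0) \<le> D" by (rule sum_positive_part_le[OF assms])
  moreover have "c * (\<Sum>j<n. max (- a j) 0) \<le> D"
    using D by (intro sum_positive_part_le[OF y large]) (simp add: sum_negf)
  moreover have "(\<Sum>j<n. \<bar>a j\<bar>) = (\<Sum>j<n. max (a j) 0) + (\<Sum>j<n. max (- a j) 0)"
    by (auto simp flip: sum.distrib intro!: sum.cong)
  ultimately show ?thesis by (simp add: distrib_left)
qed

section \<open>Ramsey arguments and diagonalisation\<close>

text \<open>Ramsey's theorem for a relation: each \<open>n\<close>-set is coloured by one chosen
  \<open>c\<close> with \<open>P F c\<close>, colours are numbered, and the infinite homogeneous set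
  is enumerated to give the subsequence.\<close>

lemma Ramsey_finite_choice:
  assumes C: "finite C" and P: "\<And>F::nat set. finite F \<Longrightarrow> card F = n \<Longrightarrow> \<exists>c\<in>C. P F c"
  shows "\<exists>(s::nat \<Rightarrow> nat) c. strict_mono s \<and> c \<in> C \<and> (\<forall>F. finite F \<and> card F = n \<and> F \<subseteq> range s \<longrightarrow> P F c)"
proof -
  obtain h where h: "bij_betw h C {0..<card C}" using ex_bij_betw_finite_nat[OF C] by blast
  obtain col where col: "\<And>F. finite F \<Longrightarrow> card F = n \<Longrightarrow> col F \<in> C \<and> P F (col F)" using P by metis
  have "\<forall>F. F \<subseteq> UNIV \<and> finite F \<and> card F = n \<longrightarrow> h (col F) < card C"
    using col bij_betwE[OF h] by fastforce
  then obtain Y t where Y: "infinite Y" "t < card C"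
    "\<And>F. F \<subseteq> Y \<Longrightarrow> finite F \<Longrightarrow> card F = n \<Longrightarrow> h (col F) = t"
    using Ramsey[of "UNIV :: nat set" n "\<lambda>F. h (col F)" "card C"] by auto
  obtain c where c: "c \<in> C" "h c = t"
    using Y(2) bij_betw_imp_surj_on[OF h] by (metis atLeastLessThan_iff imageE zero_le)
  have "P F c" if "finite F" "card F = n" "F \<subseteq> range (enumerate Y)" for F
  proof -
    have "h (col F) = h c" using that Y c range_enumerate[OF Y(1)] by simp
    then have "col F = c" using col that c(1) inj_onD[OF bij_betw_imp_inj_on[OF h]] by blast
    then show ?thesis using col that by blast
  qed
  then show ?thesis using c(1) strict_mono_enumerate[OF Y(1)] by blast
qed

text \<open>The estimate of \<open>l1_spreading\<close> on one index set, isolated so that its truth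
  value can serve as a Ramsey colour.\<close>

definition l1_lower :: "(nat \<Rightarrow> 'a::real_normed_vector) \<Rightarrow> real \<Rightarrow> nat set \<Rightarrow> bool" where
  "l1_lower y \<delta> F \<longleftrightarrow> (\<forall>\<alpha>. norm (\<Sum>i\<in>F. \<alpha> i *\<^sub>R y i) \<ge> \<delta> * (\<Sum>i\<in>F. \<bar>\<alpha> i\<bar>))"

lemma l1_lower_image:
  assumes "inj_on s F"
  shows "l1_lower y \<delta> (s ` F) \<longleftrightarrow> l1_lower (y \<circ> s) \<delta> F"
proof
  assume "l1_lower y \<delta> (s ` F)"
  then have *: "norm (\<Sum>i\<in>F. \<alpha> (s i) *\<^sub>R y (s i)) \<ge> \<delta> * (\<Sum>i\<in>F. \<bar>\<alpha> (s i)\<bar>)" for \<alpha>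
    using assms by (simp add: l1_lower_def sum.reindex)
  show "l1_lower (y \<circ> s) \<delta> F"
    unfolding l1_lower_def
  proof
    fix \<alpha>
    have "(\<Sum>i\<in>F. \<alpha> (the_inv_into F s (s i)) *\<^sub>R y (s i)) = (\<Sum>i\<in>F. \<alpha> i *\<^sub>R y (s i))"
      "(\<Sum>i\<in>F. \<bar>\<alpha> (the_inv_into F s (s i))\<bar>) = (\<Sum>i\<in>F. \<bar>\<alpha> i\<bar>)"
      using assms by (auto simp: the_inv_into_f_f intro!: sum.cong)
    then show "norm (\<Sum>i\<in>F. \<alpha> i *\<^sub>R (y \<circ> s) i) \<ge> \<delta> * (\<Sum>i\<in>F. \<bar>\<alpha> i\<bar>)"
      using *[of "\<alpha> \<circ> the_inv_into F s"] by simp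
  qed
next
  assume *: "l1_lower (y \<circ> s) \<delta> F"
  show "l1_lower y \<delta> (s ` F)"
    unfolding l1_lower_def
  proof
    fix \<alpha>
    show "norm (\<Sum>i\<in>s ` F. \<alpha> i *\<^sub>R y i) \<ge> \<delta> * (\<Sum>i\<in>s ` F. \<bar>\<alpha> i\<bar>)"
      using * assms by (simp add: l1_lower_def sum.reindex)
  qed
qed

lemma sum_sorted_list_of_set_nth:
  assumes "finite F"
  shows "(\<Sum>i\<in>F. g i) = (\<Sum>j<card F. g (sorted_list_of_set F ! j))"
proof -
  have "bij_betw ((!) (sorted_list_of_set F)) {..<card F} F"
    using assms by (intro bij_betw_nth) auto
  then show ?thesis by (simp add: sum.reindex_bij_betw)
qed

text \<open>Rounding down to multiples of \<open>1 / N\<close> leaves finitely many coefficient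
  vectors, as Ramsey's theorem requires; the extensional function space fixes the values outside
  \<open>{..<n}\<close> and so keeps the set finite.\<close>

lemma round_to_grid:
  fixes \<beta> :: "nat \<Rightarrow> real" and n N :: nat
  assumes N: "N > 0" and \<beta>: "(\<Sum>j<n. \<bar>\<beta> j\<bar>) = 1"
  obtains a where "a \<in> {..<n} \<rightarrow>\<^sub>E (\<lambda>z. real_of_int z / real N) ` {- int N..int N}"
    "\<And>j. j < n \<Longrightarrow> \<bar>a j - \<beta> j\<bar> \<le> 1 / real N"
proof -
  define a where "a = (\<lambda>j\<in>{..<n}. real_of_int \<lfloor>real N * \<beta> j\<rfloor> / real N)"
  have "\<lfloor>real N * \<beta> j\<rfloor> \<in> {- int N..int N}" if "j < n" for j
  proof -
    have "\<bar>\<beta> j\<bar> \<le> 1" using member_le_sum[of j "{..<n}" "\<lambda>j. \<bar>\<beta> j\<bar>"] that \<beta> by simp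
    then have "\<bar>real N * \<beta> j\<bar> \<le> real N" using N by (simp add: abs_mult mult_le_cancel_left1)
    then show ?thesis by (auto simp: le_floor_iff floor_le_iff)
  qed
  then have "a \<in> {..<n} \<rightarrow>\<^sub>E (\<lambda>z. real_of_int z / real N) ` {- int N..int N}"
    by (auto simp: a_def)
  moreover have "\<bar>a j - \<beta> j\<bar> \<le> 1 / real N" if "j < n" for j
  proof -
    have "\<bar>real_of_int \<lfloor>real N * \<beta> j\<rfloor> - real N * \<beta> j\<bar> \<le> 1" by linarith
    moreover have "a j - \<beta> j = (real_of_int \<lfloor>real N * \<beta> j\<rfloor> - real N * \<beta> j) / real N"
      using that N by (simp add: a_def field_simps)
    ultimately show ?thesis using N by (simp add: divide_right_mono)
  qed
  ultimately show thesis by (rule that)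
qed

text \<open>If no such set existed, Ramsey's theorem applied to the rounded bad coefficients would give
  one coefficient vector that is bad for all \<open>n\<close>-subsets of a subsequence.\<close>
lemma exists_l1_lower_set:
  fixes y :: "nat \<Rightarrow> 'a::real_normed_vector"
  assumes y: "weakly_conv y 0" and large: "hereditarily_large y c" and B: "\<And>k. norm (y k) \<le> B"
    and c: "c > 0" and \<delta>: "\<delta> < c / 2"
  shows "\<exists>F. finite F \<and> card F = n \<and> l1_lower y \<delta> F"
proof (rule ccontr)
  assume neg: "\<not> ?thesis"
  have B0: "B \<ge> 0" using B[of 0] norm_ge_zero order_trans by blast
  \<comment> \<open>The argument will end with
    \<open>c * (1 - \<kappa>) \<le> 2 * (\<delta> + B * \<kappa>)\<close>, that is,
    \<open>c / 2 - \<delta> \<le> \<kappa> * (B + c / 2)\<close>. This \<open>N\<close> makes the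
    total rounding error \<open>\<kappa> = n / N\<close> too small for that.\<close>
  obtain N :: nat where N: "real N > real n * (B + c / 2) / (c / 2 - \<delta>)" using reals_Archimedean2 by blast
  have "real n * (B + c / 2) / (c / 2 - \<delta>) \<ge> 0" using B0 c \<delta> by simp
  then have "real N > 0" using N by linarith
  then have N0: "N > 0" by simp
  define \<kappa> where "\<kappa> = real n / real N"
  have \<kappa>: "\<kappa> * (B + c / 2) < c / 2 - \<delta>"
    using N N0 \<delta> by (simp add: \<kappa>_def field_simps)
  define L where "L F = sorted_list_of_set F" for F :: "nat set"
  define C where "C = {a \<in> {..<n} \<rightarrow>\<^sub>E (\<lambda>z. real_of_int z / real N) ` {- int N..int N}.
    (\<Sum>j<n. \<bar>a j\<bar>) \<ge> 1 - \<kappa>}"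
  have "finite ({..<n} \<rightarrow>\<^sub>E (\<lambda>z. real_of_int z / real N) ` {- int N..int N})"
    by (intro finite_PiE) auto
  moreover have "C \<subseteq> {..<n} \<rightarrow>\<^sub>E (\<lambda>z. real_of_int z / real N) ` {- int N..int N}"
    unfolding C_def by (rule Collect_restrict)
  ultimately have C: "finite C" using finite_subset by blast
  have ex: "\<exists>a\<in>C. norm (\<Sum>j<n. a j *\<^sub>R y (L F ! j)) \<le> \<delta> + B * \<kappa>" if F: "finite F" "card F = n" for F
  proof -
    obtain \<alpha> where "norm (\<Sum>i\<in>F. \<alpha> i *\<^sub>R y i) < \<delta> * (\<Sum>i\<in>F. \<bar>\<alpha> i\<bar>)"
      using neg F by (auto simp: l1_lower_def not_le)
    then have \<alpha>: "norm (\<Sum>j<n. \<alpha> (L F ! j) *\<^sub>R y (L F ! j)) < \<delta> * (\<Sum>j<n. \<bar>\<alpha> (L F ! j)\<bar>)"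
      unfolding sum_sorted_list_of_set_nth[OF F(1)] L_def using F(2) by simp
    define T where "T = (\<Sum>j<n. \<bar>\<alpha> (L F ! j)\<bar>)"
    have "T \<ge> 0" by (simp add: T_def sum_nonneg)
    moreover have "T \<noteq> 0" using \<alpha> norm_ge_zero[of "\<Sum>j<n. \<alpha> (L F ! j) *\<^sub>R y (L F ! j)"] unfolding T_def[symmetric] by auto
    ultimately have T: "T > 0" by simp
    \<comment> \<open>Bad coefficients are normalised to l1-norm 1; rounding changes that norm by at
      most \<open>\<kappa>\<close> and the norm of the combination by at most
      \<open>B * \<kappa>\<close>.\<close>
    define \<beta> where "\<beta> j = \<alpha> (L F ! j) / T" for j
    have \<beta>1: "(\<Sum>j<n. \<bar>\<beta> j\<bar>) = 1" using T by (simp add: \<beta>_def flip: sum_divide_distrib T_def)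
    have "(\<Sum>j<n. \<beta> j *\<^sub>R y (L F ! j)) = (1 / T) *\<^sub>R (\<Sum>j<n. \<alpha> (L F ! j) *\<^sub>R y (L F ! j))"
      by (simp add: \<beta>_def scaleR_sum_right)
    then have \<beta>2: "norm (\<Sum>j<n. \<beta> j *\<^sub>R y (L F ! j)) < \<delta>"
      using \<alpha> T unfolding T_def[symmetric] by (simp add: field_simps)
    obtain a where a: "a \<in> {..<n} \<rightarrow>\<^sub>E (\<lambda>z. real_of_int z / real N) ` {- int N..int N}"
      "\<And>j. j < n \<Longrightarrow> \<bar>a j - \<beta> j\<bar> \<le> 1 / real N"
      using round_to_grid[OF N0 \<beta>1] by metis
    have dist: "(\<Sum>j<n. \<bar>a j - \<beta> j\<bar>) \<le> \<kappa>"
      using sum_mono[of "{..<n}" "\<lambda>j. \<bar>a j - \<beta> j\<bar>" "\<lambda>_. 1 / real N"] a(2) by (simp add: \<kappa>_def)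
    have "(\<Sum>j<n. \<bar>\<beta> j\<bar>) \<le> (\<Sum>j<n. \<bar>a j\<bar> + \<bar>a j - \<beta> j\<bar>)" by (intro sum_mono) simp
    then have "(\<Sum>j<n. \<bar>a j\<bar>) \<ge> 1 - \<kappa>" using dist \<beta>1 by (simp add: sum.distrib)
    then have "a \<in> C" using a(1) by (simp add: C_def)
    moreover have "norm (\<Sum>j<n. a j *\<^sub>R y (L F ! j)) \<le> \<delta> + B * \<kappa>"
    proof -
      have eq: "(\<Sum>j<n. a j *\<^sub>R y (L F ! j)) =
        (\<Sum>j<n. \<beta> j *\<^sub>R y (L F ! j)) + (\<Sum>j<n. (a j - \<beta> j) *\<^sub>R y (L F ! j))"
        by (simp add: scaleR_diff_left sum_subtractf)
      have "norm (\<Sum>j<n. (a j - \<beta> j) *\<^sub>R y (L F ! j)) \<le> (\<Sum>j<n. \<bar>a j - \<beta> j\<bar> * B)"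
        by (intro sum_norm_le) (simp add: B mult_left_mono)
      moreover have "(\<Sum>j<n. \<bar>a j - \<beta> j\<bar> * B) \<le> B * \<kappa>"
        using dist B0 by (simp add: mult.commute mult_left_mono flip: sum_distrib_left)
      ultimately show ?thesis
        unfolding eq
        using \<beta>2 norm_triangle_ineq[of "\<Sum>j<n. \<beta> j *\<^sub>R y (L F ! j)" "\<Sum>j<n. (a j - \<beta> j) *\<^sub>R y (L F ! j)"]
        by linarith
    qed
    ultimately show ?thesis by blast
  qed
  have "\<exists>(s::nat \<Rightarrow> nat) a. strict_mono s \<and> a \<in> C \<and> (\<forall>F. finite F \<and> card F = n \<and> F \<subseteq> range s \<longrightarrow>
      norm (\<Sum>j<n. a j *\<^sub>R y (L F ! j)) \<le> \<delta> + B * \<kappa>)"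
    using C ex by (rule Ramsey_finite_choice)
  then obtain s :: "nat \<Rightarrow> nat" and a where s: "strict_mono s" and a: "a \<in> C"
    and le: "\<forall>F. finite F \<and> card F = n \<and> F \<subseteq> range s \<longrightarrow>
      norm (\<Sum>j<n. a j *\<^sub>R y (L F ! j)) \<le> \<delta> + B * \<kappa>"
    by (elim exE conjE)
  have "c * (\<Sum>j<n. \<bar>a j\<bar>) \<le> 2 * (\<delta> + B * \<kappa>)"
  proof (rule sum_abs_le)
    show "weakly_conv (y \<circ> s) 0" using y s by (rule weakly_conv_subseq)
    show "hereditarily_large (y \<circ> s) c" using large s by (rule hereditarily_large_subseq)
    fix i :: "nat \<Rightarrow> nat" assume i: "strict_mono_on {..<n} i"
    \<comment> \<open>Increasing positions \<open>i\<close> in the subsequence correspond to an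
      \<open>n\<close>-set whose increasing enumeration is \<open>s \<circ> i\<close>.\<close>
    define F where "F = set (map (s \<circ> i) [0..<n])"
    have str: "sorted_wrt (<) (map (s \<circ> i) [0..<n])"
      using i s by (auto simp: sorted_wrt_iff_nth_less strict_mono_less strict_mono_on_def)
    then have L: "L F = map (s \<circ> i) [0..<n]"
      unfolding L_def F_def
      by (intro sorted_list_of_set.idem_if_sorted_distinct) (auto simp: strict_sorted_iff)
    have "card F = n" using str unfolding F_def by (subst distinct_card) (auto simp: strict_sorted_iff)
    then have "norm (\<Sum>j<n. a j *\<^sub>R y (L F ! j)) \<le> \<delta> + B * \<kappa>"
      by (intro le[rule_format]) (auto simp: F_def)
    then show "norm (\<Sum>j<n. a j *\<^sub>R (y \<circ> s) (i j)) \<le> \<delta> + B * \<kappa>" by (simp add: L)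
  qed
  moreover have "c * (1 - \<kappa>) \<le> c * (\<Sum>j<n. \<bar>a j\<bar>)" using a c by (simp add: C_def)
  ultimately show False using \<kappa> by (simp add: algebra_simps)
qed

text \<open>For each \<open>n\<close>, Ramsey's theorem gives a subsequence on which all
  \<open>n\<close>-sets satisfy \<open>l1_lower\<close> or none does, and
  \<open>exists_l1_lower_set\<close> excludes the latter. A diagonal sequence handles all
  \<open>n\<close> at once.\<close>

lemma exists_l1_spreading_subseq:
  fixes y :: "nat \<Rightarrow> 'a::real_normed_vector"
  assumes y: "weakly_conv y 0" and large: "hereditarily_large y c" and B: "\<And>k. norm (y k) \<le> B"
    and c: "c > 0" and \<delta>: "\<delta> < c / 2"
  obtains r where "strict_mono r" "l1_spreading (y \<circ> r) \<delta>"
proof -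
  define P where "P n s \<longleftrightarrow> (\<forall>F. finite F \<and> card F = n \<longrightarrow> l1_lower (y \<circ> s) \<delta> F)" for n and s :: "nat \<Rightarrow> nat"
  interpret subseqs P
  proof
    fix n and s :: "nat \<Rightarrow> nat" assume s: "strict_mono s"
    \<comment> \<open>The colour \<open>b\<close> is the truth value of the lower estimate
      itself.\<close>
    have "\<exists>(r::nat \<Rightarrow> nat) b. strict_mono r \<and> b \<in> UNIV \<and>
        (\<forall>F. finite F \<and> card F = n \<and> F \<subseteq> range r \<longrightarrow> b = l1_lower (y \<circ> s) \<delta> F)"
      by (rule Ramsey_finite_choice) auto
    then obtain r :: "nat \<Rightarrow> nat" and b where r: "strict_mono r"
      and b: "\<forall>F. finite F \<and> card F = n \<and> F \<subseteq> range r \<longrightarrow> b = l1_lower (y \<circ> s) \<delta> F"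
      by (elim exE conjE)
    have sr: "strict_mono (s \<circ> r)" using s r by (rule strict_mono_o)
    have iff: "b \<longleftrightarrow> l1_lower (y \<circ> (s \<circ> r)) \<delta> F" if "finite F" "card F = n" for F
    proof -
      have inj: "inj_on r F" using strict_mono_imp_inj_on[OF r] inj_on_subset by blast
      then have "b = l1_lower (y \<circ> s) \<delta> (r ` F)" using that by (intro b[rule_format]) (auto simp: card_image)
      then show ?thesis by (simp only: l1_lower_image[OF inj] comp_assoc)
    qed
    have "norm ((y \<circ> (s \<circ> r)) k) \<le> B" for k using B by simp
    then obtain F where "finite F" "card F = n" "l1_lower (y \<circ> (s \<circ> r)) \<delta> F"
      using exists_l1_lower_set[OF weakly_conv_subseq[OF y sr] hereditarily_large_subseq[OF large sr] _ c \<delta>]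
      by blast
    then have b using iff by blast
    then have "P n (s \<circ> r)" unfolding P_def using iff by blast
    then show "\<exists>r'. strict_mono r' \<and> P n (s \<circ> r')" using r by blast
  qed
  \<comment> \<open>The diagonal sequence is good for \<open>n\<close>-sets from index
    \<open>n + 1\<close> on. If \<open>card F = n \<le> Min F + 1\<close>, every
    \<open>i \<in> F\<close> satisfies \<open>i + 2 \<ge> n + 1\<close>, which dictates the shift by
    2.\<close>
  define r where "r k = diagseq (k + 2)" for k
  have P: "P n (diagseq \<circ> (+) (Suc n))" for n
  proof (rule diagseq_holds)
    fix t s :: "nat \<Rightarrow> nat" and m assume t: "strict_mono t" and Pms: "P m s"
    show "P m (s \<circ> t)"
      unfolding P_def
    proof (intro allI impI)
      fix F :: "nat set" assume F: "finite F \<and> card F = m"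
      have inj: "inj_on t F" using strict_mono_imp_inj_on[OF t] inj_on_subset by blast
      then have "l1_lower (y \<circ> s) \<delta> (t ` F)" using F Pms by (simp add: P_def card_image)
      then show "l1_lower (y \<circ> (s \<circ> t)) \<delta> F" by (simp only: l1_lower_image[OF inj] comp_assoc)
    qed
  qed
  have "l1_spreading (y \<circ> r) \<delta>"
    unfolding l1_spreading_def
  proof (intro allI impI)
    fix F :: "nat set" and \<alpha> assume F: "finite F \<and> F \<noteq> {} \<and> card F \<le> Min F + 1"
    have ge: "card F \<le> i + 1" if "i \<in> F" for i
    proof -
      have "Min F \<le> i" using F that by (intro Min_le) auto
      then show ?thesis using F by linarith
    qed
    define t where "t i = i + 1 - card F" for i
    have inj: "inj_on t F" using ge by (intro inj_onI) (metis t_def add_right_cancel eq_diff_iff)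
    have rt: "r i = (diagseq \<circ> (+) (Suc (card F))) (t i)" if "i \<in> F" for i
      using ge[OF that] by (simp add: r_def t_def)
    have "l1_lower (y \<circ> (diagseq \<circ> (+) (Suc (card F)))) \<delta> (t ` F)"
      using P[of "card F"] F inj by (simp add: P_def card_image)
    then have "l1_lower (y \<circ> (diagseq \<circ> (+) (Suc (card F))) \<circ> t) \<delta> F" by (simp only: l1_lower_image[OF inj])
    moreover have "(\<Sum>i\<in>F. \<alpha> i *\<^sub>R (y \<circ> r) i) =
        (\<Sum>i\<in>F. \<alpha> i *\<^sub>R (y \<circ> (diagseq \<circ> (+) (Suc (card F))) \<circ> t) i)"
      using rt by (intro sum.cong) auto
    ultimately show "norm (\<Sum>i\<in>F. \<alpha> i *\<^sub>R (y \<circ> r) i) \<ge> \<delta> * (\<Sum>i\<in>F. \<bar>\<alpha> i\<bar>)"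
      unfolding l1_lower_def by presburger
  qed
  moreover have "strict_mono r" using subseq_diagseq by (simp add: r_def strict_mono_def)
  ultimately show thesis using that by blast
qed

section \<open>Comparison of the quantities\<close>

text \<open>The bound \<open>B\<close> makes the real suprema meaningful. From below, pairs
  arbitrarily far out are needed; from above, a single tail suffices.\<close>

lemma ca_bounds:
  fixes x :: "nat \<Rightarrow> 'a::real_normed_vector"
  assumes B: "\<And>k. norm (x k) \<le> B"
  shows ca_ge: "(\<And>n. \<exists>k\<ge>n. \<exists>l\<ge>n. m \<le> norm (x k - x l)) \<Longrightarrow> m \<le> ca x"
    and ca_le: "(\<And>k l. k \<ge> N \<Longrightarrow> l \<ge> N \<Longrightarrow> norm (x k - x l) \<le> e) \<Longrightarrow> ca x \<le> e"
    and ca_nonneg: "0 \<le> ca x"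
proof -
  define g where "g n = (SUP p \<in> {n..} \<times> {n..}. norm (x (fst p) - x (snd p)))" for n :: nat
  have bdd: "bdd_above ((\<lambda>p. norm (x (fst p) - x (snd p))) ` ({n..} \<times> {n..}))" for n
  proof (rule bdd_aboveI2)
    fix p show "norm (x (fst p) - x (snd p)) \<le> 2 * B"
      using norm_triangle_ineq4[of "x (fst p)" "x (snd p)"] B[of "fst p"] B[of "snd p"] by simp
  qed
  have up: "norm (x k - x l) \<le> g n" if "k \<ge> n" "l \<ge> n" for k l n
    using cSUP_upper[OF _ bdd, of "(k, l)" n] that by (simp add: g_def)
  have ca: "ca x = (INF n. g n)" by (simp add: ca_def g_def)
  have pos: "0 \<le> g n" for n using up[of n n n] by simp
  have bb: "bdd_below (range g)" using pos by (meson bdd_belowI2)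
  show "m \<le> ca x" if "\<And>n. \<exists>k\<ge>n. \<exists>l\<ge>n. m \<le> norm (x k - x l)"
    unfolding ca
  proof (rule cINF_greatest)
    fix n
    obtain k l where "k \<ge> n" "l \<ge> n" "m \<le> norm (x k - x l)" using \<open>\<And>n. \<exists>k\<ge>n. \<exists>l\<ge>n. m \<le> norm (x k - x l)\<close> by blast
    then show "m \<le> g n" using up[of n k l] by simp
  qed simp
  show "ca x \<le> e" if "\<And>k l. k \<ge> N \<Longrightarrow> l \<ge> N \<Longrightarrow> norm (x k - x l) \<le> e"
  proof -
    have "g N \<le> e" unfolding g_def using that by (intro cSUP_least) auto
    then show ?thesis unfolding ca using cINF_lower[OF bb, of N] by simp
  qed
  show "0 \<le> ca x" unfolding ca using pos by (intro cINF_greatest) auto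
qed

text \<open>Index \<open>k\<close> averages \<open>k + 1\<close> terms, so the mean of the first
  \<open>m\<close> terms is \<open>cmean x (m - 1)\<close>.\<close>

definition cmean :: "(nat \<Rightarrow> 'a::real_normed_vector) \<Rightarrow> nat \<Rightarrow> 'a" where
  "cmean x k = (1 / real (Suc k)) *\<^sub>R (\<Sum>i<Suc k. x i)"

lemma cca_eq_ca_cmean: "cca x = ca (cmean x)"
  by (simp add: cca_def cmean_def[abs_def])

lemma norm_cmean_le:
  assumes "\<And>k. norm (x k) \<le> B" shows "norm (cmean x k) \<le> B"
proof -
  have "norm (\<Sum>i<Suc k. x i) \<le> real (card {..<Suc k}) * B"
    using assms by (intro sum_norm_bound) auto
  then show ?thesis by (simp add: cmean_def field_simps del: sum.lessThan_Suc of_nat_Suc)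
qed

lemma cmean_diff: "cmean (\<lambda>k. x k - l) k = cmean x k - l"
proof -
  have "(\<Sum>i<Suc k. x i - l) = (\<Sum>i<Suc k. x i) - real (Suc k) *\<^sub>R l"
    by (simp only: sum_subtractf sum_constant_scaleR card_lessThan)
  then show ?thesis unfolding cmean_def
    by (simp only: scaleR_diff_right scaleR_scaleR) simp
qed

lemma cca_nonneg: "(\<And>k. norm (x k) \<le> B) \<Longrightarrow> 0 \<le> cca x"
  unfolding cca_eq_ca_cmean by (rule ca_nonneg) (rule norm_cmean_le)

lemma cca_le: "(\<And>k. norm (x k) \<le> B) \<Longrightarrow> cca x \<le> 2 * B"
  unfolding cca_eq_ca_cmean
proof (rule ca_le[where N=0 and B=B])
  fix k l assume "\<And>k. norm (x k) \<le> B"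
  then show "norm (cmean x k) \<le> B" "norm (cmean x k - cmean x l) \<le> 2 * B"
    using norm_cmean_le[of x B k] norm_cmean_le[of x B l] norm_triangle_ineq4[of "cmean x k" "cmean x l"] by auto
qed

lemma cca_tilde_le:
  assumes "\<And>k. norm (x k) \<le> B" "strict_mono r" shows "cca_tilde x \<le> cca (x \<circ> r)"
  unfolding cca_tilde_def
proof (rule cINF_lower)
  show "bdd_below ((\<lambda>r. cca (x \<circ> r)) ` {r. strict_mono r})"
    using assms(1) by (intro bdd_belowI2[of _ 0] cca_nonneg[of _ B]) auto
qed (use assms in auto)

lemma le_cca_tilde:
  assumes "\<And>r::nat \<Rightarrow> nat. strict_mono r \<Longrightarrow> m \<le> cca (x \<circ> r)" shows "m \<le> cca_tilde x"
  unfolding cca_tilde_def using strict_mono_id assms by (intro cINF_greatest) (auto intro: exI[of _ id])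

lemma cca_tilde_le_bound:
  assumes "\<And>k. norm (x k) \<le> B" shows "cca_tilde x \<le> 2 * B"
  using cca_tilde_le[of x B id, OF _ strict_mono_id] cca_le[of x B] assms by simp

lemma cca_tilde_le_wbs:
  assumes B: "\<And>a. a \<in> A \<Longrightarrow> norm a \<le> B" and x: "range x \<subseteq> A" "weakly_conv x l"
  shows "cca_tilde x \<le> wbs A"
  unfolding wbs_def
proof (rule cSup_upper)
  have "cca_tilde z \<le> max 0 (2 * B)" if "range z \<subseteq> A" for z
    using cca_tilde_le_bound[of z B] B that by (fastforce simp: max_def)
  then show "bdd_above (insert 0 {cca_tilde x |x. range x \<subseteq> A \<and> (\<exists>l. weakly_conv x l)})"
    by (intro bdd_aboveI[of _ "max 0 (2 * B)"]) auto
qed (use x in auto)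

lemma wbs_le:
  assumes "0 \<le> m" "\<And>x l. range x \<subseteq> A \<Longrightarrow> weakly_conv x l \<Longrightarrow> cca_tilde x \<le> m"
  shows "wbs A \<le> m"
  unfolding wbs_def using assms by (intro cSup_least) auto

text \<open>Thinning out along fourth powers makes the spreading condition admit the index sets
  \<open>{j..<j^4}\<close>, which carry almost all the mass of the difference of the means of the first
  \<open>j^2\<close> and the first \<open>j^4\<close> terms.\<close>
lemma l1_spreading_cca_ge:
  fixes y :: "nat \<Rightarrow> 'a::real_normed_vector"
  assumes sp: "l1_spreading y \<delta>" and B: "\<And>k. norm (y k) \<le> B"
    and s: "strict_mono s" "\<And>k. k ^ 4 \<le> s k"
  shows "2 * \<delta> \<le> cca (y \<circ> s)"
proof -
  \<comment> \<open>The difference has coefficients \<open>1/j^2 - 1/j^4\<close> below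
    \<open>j^2\<close> and \<open>- 1/j^4\<close> from there to \<open>j^4\<close>. The first
    \<open>j\<close> terms cost at most \<open>j * B / j^2\<close>; the absolute values of the
    others sum to a quantity tending to 2.\<close>
  have main: "\<delta> * ((1 - 1 / real j) * (1 - 1 / real j ^ 2) + 1 - 1 / real j ^ 2) - B / real j
      \<le> norm (cmean (y \<circ> s) (j ^ 2 - 1) - cmean (y \<circ> s) (j ^ 4 - 1))" if j: "j \<ge> 2" for j
  proof -
    have j24: "j < j ^ 2" "j ^ 2 < j ^ 4"
      using j power_strict_increasing[of 1 2 j] power_strict_increasing[of 2 4 j] by auto
    have j0: "0 < real j" using j by simp
    have Suc2: "Suc (j ^ 2 - 1) = j ^ 2" and Suc4: "Suc (j ^ 4 - 1) = j ^ 4" using j24 by auto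
    define a where "a i = (if i < j ^ 2 then 1 / real j ^ 2 - 1 / real j ^ 4 else - (1 / real j ^ 4))" for i
    have inv: "1 / real j ^ 4 \<le> 1 / real j ^ 2"
      using j24 j0 by (intro divide_left_mono) (auto simp flip: of_nat_power)
    have split4: "{..<j ^ 4} = {..<j ^ 2} \<union> {j ^ 2..<j ^ 4}" using j24 by auto
    have split: "{..<j ^ 4} = {..<j} \<union> {j..<j ^ 4}" using j24 by auto
    have splitF: "{j..<j ^ 4} = {j..<j ^ 2} \<union> {j ^ 2..<j ^ 4}" using j24 by auto
    let ?P = "\<Sum>i<j. a i *\<^sub>R y (s i)" and ?Q = "\<Sum>i\<in>{j..<j ^ 4}. a i *\<^sub>R y (s i)"
    have e1: "cmean (y \<circ> s) (j ^ 2 - 1) = (\<Sum>i<j ^ 2. (1 / real j ^ 2) *\<^sub>R y (s i))"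
      unfolding cmean_def Suc2 by (simp add: scaleR_sum_right)
    have e2: "cmean (y \<circ> s) (j ^ 4 - 1) =
        (\<Sum>i<j ^ 2. (1 / real j ^ 4) *\<^sub>R y (s i)) + (\<Sum>i\<in>{j ^ 2..<j ^ 4}. (1 / real j ^ 4) *\<^sub>R y (s i))"
    proof -
      have "cmean (y \<circ> s) (j ^ 4 - 1) = (\<Sum>i<j ^ 4. (1 / real j ^ 4) *\<^sub>R y (s i))"
        unfolding cmean_def Suc4 by (simp add: scaleR_sum_right)
      then show ?thesis unfolding split4 by (simp add: sum.union_disjoint ivl_disj_int)
    qed
    have e3: "(\<Sum>i<j ^ 4. a i *\<^sub>R y (s i)) = (\<Sum>i<j ^ 2. a i *\<^sub>R y (s i)) + (\<Sum>i\<in>{j ^ 2..<j ^ 4}. a i *\<^sub>R y (s i))"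
      unfolding split4 by (rule sum.union_disjoint) auto
    have e4: "(\<Sum>i<j ^ 2. a i *\<^sub>R y (s i)) =
        (\<Sum>i<j ^ 2. (1 / real j ^ 2) *\<^sub>R y (s i)) - (\<Sum>i<j ^ 2. (1 / real j ^ 4) *\<^sub>R y (s i))"
      by (simp add: a_def scaleR_diff_left sum_subtractf)
    have e5: "(\<Sum>i\<in>{j ^ 2..<j ^ 4}. a i *\<^sub>R y (s i)) = - (\<Sum>i\<in>{j ^ 2..<j ^ 4}. (1 / real j ^ 4) *\<^sub>R y (s i))"
      by (simp add: a_def sum_negf)
    have e6: "(\<Sum>i<j ^ 4. a i *\<^sub>R y (s i)) = ?P + ?Q"
      unfolding split by (rule sum.union_disjoint) auto
    have "?Q + ?P = (\<Sum>i<j ^ 4. a i *\<^sub>R y (s i))" by (simp only: e6 add.commute)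
    also have "\<dots> = cmean (y \<circ> s) (j ^ 2 - 1) - cmean (y \<circ> s) (j ^ 4 - 1)"
      by (simp only: e1 e2 e3 e4 e5 diff_conv_add_uminus minus_add_distrib add.assoc)
    finally have eq: "cmean (y \<circ> s) (j ^ 2 - 1) - cmean (y \<circ> s) (j ^ 4 - 1) = ?Q + ?P" by (rule sym)
    have "norm (\<Sum>i<j. a i *\<^sub>R y (s i)) \<le> B / real j"
    proof -
      have "norm (a i *\<^sub>R y (s i)) \<le> 1 / real j ^ 2 * B" if "i < j" for i
      proof -
        have "\<bar>a i\<bar> \<le> 1 / real j ^ 2" using inv that j24 by (simp add: a_def)
        then have "\<bar>a i\<bar> * norm (y (s i)) \<le> 1 / real j ^ 2 * B"
          using B[of "s i"] by (intro mult_mono) auto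
        then show ?thesis by simp
      qed
      then have "norm (\<Sum>i<j. a i *\<^sub>R y (s i)) \<le> real (card {..<j}) * (1 / real j ^ 2 * B)"
        by (intro sum_norm_bound) auto
      also have "\<dots> = B / real j" using j0 by (simp add: power2_eq_square)
      finally show ?thesis .
    qed
    moreover have "norm (\<Sum>i\<in>{j..<j ^ 4}. a i *\<^sub>R y (s i)) \<ge>
        \<delta> * ((1 - 1 / real j) * (1 - 1 / real j ^ 2) + 1 - 1 / real j ^ 2)"
    proof -
      have inj: "inj s" using s(1) by (rule strict_mono_imp_inj_on)
      define F where "F = s ` {j..<j ^ 4}"
      have F: "finite F" "F \<noteq> {}" using j24 by (auto simp: F_def)
      \<comment> \<open>From \<open>i \<ge> j\<close> follows
        \<open>s i \<ge> i^4 \<ge> j^4\<close>, so this set of at most \<open>j^4\<close> indices is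
        admissible.\<close>
      have "j ^ 4 \<le> Min F" using F
      proof (subst Min_ge_iff)
        show "\<forall>a\<in>F. j ^ 4 \<le> a"
          using s(2) by (auto simp: F_def intro: order_trans[OF power_mono])
      qed auto
      moreover have "card F \<le> j ^ 4" using card_image_le[of "{j..<j ^ 4}" s] by (simp add: F_def)
      ultimately have "card F \<le> Min F + 1" by linarith
      with F have "finite F \<and> F \<noteq> {} \<and> card F \<le> Min F + 1" by (intro conjI)
      then have "\<delta> * (\<Sum>i\<in>F. \<bar>a (inv s i)\<bar>) \<le> norm (\<Sum>i\<in>F. a (inv s i) *\<^sub>R y i)"
        by (rule sp[unfolded l1_spreading_def, rule_format])
      moreover have "inj_on s {j..<j ^ 4}" using inj inj_on_subset by blast
      ultimately have "\<delta> * (\<Sum>i\<in>{j..<j ^ 4}. \<bar>a i\<bar>) \<le> norm (\<Sum>i\<in>{j..<j ^ 4}. a i *\<^sub>R y (s i))"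
        using inj by (simp add: F_def sum.reindex inv_f_f)
      moreover have "(\<Sum>i\<in>{j..<j ^ 4}. \<bar>a i\<bar>) = (1 - 1 / real j) * (1 - 1 / real j ^ 2) + 1 - 1 / real j ^ 2"
      proof -
        have "(\<Sum>i\<in>{j..<j ^ 4}. \<bar>a i\<bar>) = (\<Sum>i\<in>{j..<j ^ 2}. \<bar>a i\<bar>) + (\<Sum>i\<in>{j ^ 2..<j ^ 4}. \<bar>a i\<bar>)"
          unfolding splitF by (rule sum.union_disjoint) auto
        also have "(\<Sum>i\<in>{j..<j ^ 2}. \<bar>a i\<bar>) = (real j ^ 2 - real j) * (1 / real j ^ 2 - 1 / real j ^ 4)"
          using inv j24 by (simp add: a_def of_nat_diff)
        also have "(\<Sum>i\<in>{j ^ 2..<j ^ 4}. \<bar>a i\<bar>) = (real j ^ 4 - real j ^ 2) * (1 / real j ^ 4)"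
          using j24 by (simp add: a_def of_nat_diff)
        also have "(real j ^ 2 - real j) * (1 / real j ^ 2 - 1 / real j ^ 4) + (real j ^ 4 - real j ^ 2) * (1 / real j ^ 4)
            = (1 - 1 / real j) * (1 - 1 / real j ^ 2) + 1 - 1 / real j ^ 2"
        proof -
          \<comment> \<open>With \<open>u\<close> for \<open>1 / real j\<close>, the claim is a
            polynomial identity modulo \<open>real j * u = 1\<close>.\<close>
          define u where "u = 1 / real j"
          have "real j * u = 1" using j0 by (simp add: u_def)
          then have "(real j ^ 2 - real j) * (u ^ 2 - u ^ 4) + (real j ^ 4 - real j ^ 2) * u ^ 4
              = (1 - u) * (1 - u ^ 2) + 1 - u ^ 2"
            by algebra
          then show ?thesis by (simp only: u_def power_one_over)
        qed
        finally show ?thesis .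
      qed
      ultimately show ?thesis by simp
    qed
    ultimately show ?thesis
      unfolding eq using norm_diff_ineq[of ?Q ?P] by linarith
  qed
  have sq: "(\<lambda>j. 1 / real j ^ 2) \<longlonglongrightarrow> 0"
    using tendsto_power[OF lim_1_over_n[where 'a=real], of 2] by (simp add: power_one_over)
  have lim: "(\<lambda>j. \<delta> * ((1 - 1 / real j) * (1 - 1 / real j ^ 2) + 1 - 1 / real j ^ 2) - B / real j)
      \<longlonglongrightarrow> \<delta> * ((1 - 0) * (1 - 0) + 1 - 0) - 0"
    by (intro tendsto_add tendsto_diff tendsto_mult tendsto_const lim_const_over_n lim_1_over_n sq)
  show ?thesis
  proof (rule field_le_epsilon)
    fix e :: real assume e: "e > 0"
    have ev: "\<forall>\<^sub>F j in sequentially. 2 * \<delta> - e <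
        \<delta> * ((1 - 1 / real j) * (1 - 1 / real j ^ 2) + 1 - 1 / real j ^ 2) - B / real j"
      using e by (intro order_tendstoD(1)[OF lim]) simp
    have "2 * \<delta> - e \<le> ca (cmean (y \<circ> s))"
    proof (rule ca_ge[where B=B])
      show "norm (cmean (y \<circ> s) k) \<le> B" for k using B by (intro norm_cmean_le) auto
      fix n
      have "\<forall>\<^sub>F j in sequentially. j \<ge> n + 2" by (rule eventually_ge_at_top)
      with ev have "\<forall>\<^sub>F j in sequentially. j \<ge> n + 2 \<and> 2 * \<delta> - e <
        \<delta> * ((1 - 1 / real j) * (1 - 1 / real j ^ 2) + 1 - 1 / real j ^ 2) - B / real j"
        by (rule eventually_elim2) auto
      then obtain j where j: "j \<ge> n + 2" "2 * \<delta> - e <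
        \<delta> * ((1 - 1 / real j) * (1 - 1 / real j ^ 2) + 1 - 1 / real j ^ 2) - B / real j"
        by (auto simp: eventually_sequentially)
      have "n \<le> j ^ 2 - 1" "n \<le> j ^ 4 - 1"
        using j(1) self_le_power[of j 2] self_le_power[of j 4] by auto
      then show "\<exists>k\<ge>n. \<exists>l\<ge>n. 2 * \<delta> - e \<le> norm (cmean (y \<circ> s) k - cmean (y \<circ> s) l)"
        using main[of j] j by (intro exI[of _ "j ^ 2 - 1"] exI[of _ "j ^ 4 - 1"] conjI) auto
    qed
    then show "2 * \<delta> \<le> cca (y \<circ> s) + e" by (simp add: cca_eq_ca_cmean)
  qed
qed

lemma cca_diff: "cca (\<lambda>k. x k - l) = cca x"
  by (simp add: cca_eq_ca_cmean ca_def cmean_diff)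

text \<open>Thinning along \<open>k^4\<close> once is enough: any further subsequence grows at least
  as fast, so the lower bound holds for all of them and passes to \<open>cca_tilde\<close>. The weak
  limit cancels in differences of means.\<close>

lemma l1_spreading_le_wbs:
  fixes A :: "'a::real_normed_vector set"
  assumes B: "\<And>a. a \<in> A \<Longrightarrow> norm a \<le> B" and x: "range x \<subseteq> A" "weakly_conv x l"
    and sp: "l1_spreading (\<lambda>k. x k - l) \<delta>"
  shows "2 * \<delta> \<le> wbs A"
proof -
  define q where "q k = k ^ 4" for k :: nat
  have q: "strict_mono q" by (auto simp: strict_mono_def q_def power_strict_mono)
  have nx: "norm (x k) \<le> B" for k using B x by blast
  then have nB: "norm (x k - l) \<le> B + norm l" for k
    by (rule order_trans[OF norm_triangle_ineq4 add_right_mono])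
  have "2 * \<delta> \<le> cca_tilde (x \<circ> q)"
  proof (rule le_cca_tilde)
    fix r :: "nat \<Rightarrow> nat" assume r: "strict_mono r"
    have "k ^ 4 \<le> (q \<circ> r) k" for k using seq_suble[OF r, of k] by (simp add: q_def power_mono)
    then have "2 * \<delta> \<le> cca ((\<lambda>k. x k - l) \<circ> (q \<circ> r))"
      using l1_spreading_cca_ge[OF sp nB strict_mono_o[OF q r]] by blast
    also have "(\<lambda>k. x k - l) \<circ> (q \<circ> r) = (\<lambda>k. (x \<circ> q \<circ> r) k - l)" by auto
    finally show "2 * \<delta> \<le> cca (x \<circ> q \<circ> r)" by (simp only: cca_diff)
  qed
  also have "\<dots> \<le> wbs A"
    using x weakly_conv_subseq[OF x(2) q] by (intro cca_tilde_le_wbs[OF B]) auto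
  finally show ?thesis .
qed

section \<open>The quantity wu and the second inequality\<close>

text \<open>Finiteness is a separate clause because \<open>card\<close> is 0 on infinite
  sets.\<close>

definition wu_bound :: "(nat \<Rightarrow> 'a::real_normed_vector) \<Rightarrow> 'a \<Rightarrow> real \<Rightarrow> bool" where
  "wu_bound x l \<epsilon> \<longleftrightarrow> \<epsilon> > 0 \<and> (\<exists>n::nat. \<forall>f \<in> dual_ball.
       finite {k. \<bar>f (x k - l)\<bar> > \<epsilon>} \<and> card {k. \<bar>f (x k - l)\<bar> > \<epsilon>} \<le> n)"

lemma wu_seq_eq: "wu_seq x l = Inf {\<epsilon>. wu_bound x l \<epsilon>}"
  by (simp add: wu_seq_def wu_bound_def)

lemma wu_seq_le: "wu_bound x l \<epsilon> \<Longrightarrow> wu_seq x l \<le> \<epsilon>"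
  unfolding wu_seq_eq by (rule cInf_lower) (auto simp: wu_bound_def intro!: bdd_belowI[of _ 0])

text \<open>Ensures that \<open>wu_seq\<close> is the infimum of a nonempty set. Each functional
  bounds its own value at the limit by \<open>B\<close>; the added 1 makes the bound positive even
  if \<open>B = 0\<close>.\<close>

lemma wu_bound_of_bounded:
  fixes x :: "nat \<Rightarrow> 'a::real_normed_vector"
  assumes B: "\<And>k. norm (x k) \<le> B" and x: "weakly_conv x l"
  shows "wu_bound x l (2 * B + 1)"
proof -
  have B0: "B \<ge> 0" using B[of 0] norm_ge_zero order_trans by blast
  have "\<bar>f (x k - l)\<bar> \<le> 2 * B + 1" if f: "f \<in> dual_ball" for f k
  proof -
    have bl: "bounded_linear f" using f by (simp add: dual_ball_def)
    have fx: "\<bar>f (x k)\<bar> \<le> B" for k using dual_ball_abs_le[OF f, of "x k"] B[of k] by simp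
    have "(\<lambda>k. \<bar>f (x k)\<bar>) \<longlonglongrightarrow> \<bar>f l\<bar>" using x bl by (intro tendsto_rabs) (simp add: weakly_conv_def)
    then have "\<bar>f l\<bar> \<le> B" using fx by (intro LIMSEQ_le_const2) auto
    then show ?thesis using fx[of k] bl by (simp add: linear_simps)
  qed
  then have "{k. \<bar>f (x k - l)\<bar> > 2 * B + 1} = {}" if "f \<in> dual_ball" for f
    using that by (auto simp: not_less)
  then show ?thesis using B0 by (auto simp: wu_bound_def)
qed

lemma le_wu_seq:
  assumes "\<And>k. norm (x k) \<le> B" "weakly_conv x l" "\<And>\<epsilon>. wu_bound x l \<epsilon> \<Longrightarrow> m \<le> \<epsilon>"
  shows "m \<le> wu_seq x l"
  unfolding wu_seq_eq using wu_bound_of_bounded[OF assms(1,2)] assms(3) by (intro cInf_greatest) auto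

lemma wu_tilde_le:
  assumes B: "\<And>k. norm (x k) \<le> B" and x: "weakly_conv x l" and r: "strict_mono r"
  shows "wu_tilde x l \<le> wu_seq (x \<circ> r) l"
  unfolding wu_tilde_def
proof (rule cINF_lower)
  show "bdd_below ((\<lambda>r. wu_seq (x \<circ> r) l) ` {r. strict_mono r})"
    using B weakly_conv_subseq[OF x]
    by (intro bdd_belowI2[of _ 0] le_wu_seq[where B=B]) (auto simp: wu_bound_def)
qed (use r in auto)

lemma le_wu_tilde:
  assumes B: "\<And>k. norm (x k) \<le> B" and x: "weakly_conv x l"
    and m: "\<And>r \<epsilon>. strict_mono r \<Longrightarrow> wu_bound (x \<circ> r) l \<epsilon> \<Longrightarrow> m \<le> \<epsilon>"
  shows "m \<le> wu_tilde x l"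
  unfolding wu_tilde_def
proof (rule cINF_greatest)
  show "{r::nat \<Rightarrow> nat. strict_mono r} \<noteq> {}" using strict_mono_id by blast
  fix r :: "nat \<Rightarrow> nat" assume "r \<in> {r. strict_mono r}"
  then show "m \<le> wu_seq (x \<circ> r) l" using B m weakly_conv_subseq[OF x] by (intro le_wu_seq[where B=B]) auto
qed

lemma wu_tilde_le_wu:
  assumes B: "\<And>a. a \<in> A \<Longrightarrow> norm a \<le> B" and x: "range x \<subseteq> A" "weakly_conv x l"
  shows "wu_tilde x l \<le> wu A"
  unfolding wu_def
proof (rule cSup_upper)
  have "wu_tilde z m \<le> max 0 (2 * B + 1)" if z: "range z \<subseteq> A" "weakly_conv z m" for z m
  proof -
    have zB: "norm (z k) \<le> B" for k using B z by blast
    have "wu_tilde z m \<le> wu_seq z m" using wu_tilde_le[OF zB z(2) strict_mono_id] by simp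
    also have "\<dots> \<le> 2 * B + 1" by (rule wu_seq_le) (rule wu_bound_of_bounded[OF zB z(2)])
    finally show ?thesis by simp
  qed
  then show "bdd_above (insert 0 {wu_tilde x l |x l. range x \<subseteq> A \<and> weakly_conv x l})"
    by (intro bdd_aboveI[of _ "max 0 (2 * B + 1)"]) auto
qed (use x in auto)

lemma wu_le:
  assumes "0 \<le> m" "\<And>x l. range x \<subseteq> A \<Longrightarrow> weakly_conv x l \<Longrightarrow> wu_tilde x l \<le> m"
  shows "wu A \<le> m"
  unfolding wu_def using assms by (intro cSup_least) auto

text \<open>The number \<open>n\<close> of exceptional terms is the same for all functionals, so the
  mean of \<open>k + 1\<close> terms has norm at most \<open>\<epsilon> + n * M / (k + 1)\<close>;
  the difference of two late means then costs \<open>2 * \<epsilon>\<close>.\<close>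

lemma cca_le_wu_bound:
  fixes x :: "nat \<Rightarrow> 'a::real_normed_vector"
  assumes B: "\<And>k. norm (x k) \<le> B" and wb: "wu_bound x l \<epsilon>"
  shows "cca x \<le> 2 * \<epsilon>"
proof -
  define M where "M = B + norm l"
  define y where "y k = x k - l" for k
  have yM: "norm (y k) \<le> M" for k
    unfolding M_def y_def using B by (rule order_trans[OF norm_triangle_ineq4 add_right_mono])
  have M0: "M \<ge> 0" using yM[of 0] norm_ge_zero order_trans by blast
  have \<epsilon>: "\<epsilon> > 0" using wb by (simp add: wu_bound_def)
  obtain n where n: "\<And>f. f \<in> dual_ball \<Longrightarrow> finite {k. \<bar>f (y k)\<bar> > \<epsilon>} \<and> card {k. \<bar>f (y k)\<bar> > \<epsilon>} \<le> n"
    using wb unfolding wu_bound_def y_def by blast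
  have mean: "norm (cmean y k) \<le> \<epsilon> + real n * M / real (Suc k)" for k
  proof (rule norm_le_if_dual_ball_le)
    fix f :: "'a \<Rightarrow> real" assume f: "f \<in> dual_ball"
    define S where "S = {k. \<bar>f (y k)\<bar> > \<epsilon>}"
    have S: "finite S" "card S \<le> n" using n[OF f] by (auto simp: S_def)
    have lin: "linear f" using f bounded_linear.linear by (auto simp: dual_ball_def)
    have "(\<Sum>i<Suc k. f (y i)) \<le> (\<Sum>i<Suc k. \<epsilon> + (if i \<in> S then M else 0))"
    proof (rule sum_mono)
      fix i
      show "f (y i) \<le> \<epsilon> + (if i \<in> S then M else 0)"
        using dual_ball_abs_le[OF f, of "y i"] yM[of i] \<epsilon> by (auto simp: S_def)
    qed
    also have "\<dots> = real (Suc k) * \<epsilon> + (\<Sum>i\<in>{..<Suc k} \<inter> S. M)"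
      by (simp only: sum.distrib sum.inter_restrict[OF finite_lessThan]) simp
    also have "(\<Sum>i\<in>{..<Suc k} \<inter> S. M) \<le> real n * M"
    proof -
      have "card ({..<Suc k} \<inter> S) \<le> n" using S card_mono[of S "{..<Suc k} \<inter> S"] by auto
      then show ?thesis using M0 by (simp add: mult_right_mono)
    qed
    finally have "(\<Sum>i<Suc k. f (y i)) \<le> real (Suc k) * \<epsilon> + real n * M" by simp
    moreover have "f (cmean y k) = (\<Sum>i<Suc k. f (y i)) / real (Suc k)"
      using lin by (simp only: cmean_def linear_scale linear_sum) simp
    ultimately show "f (cmean y k) \<le> \<epsilon> + real n * M / real (Suc k)"
      by (simp add: field_simps del: sum.lessThan_Suc)
  qed
  show ?thesis
  proof (rule field_le_epsilon)
    fix e :: real assume e: "e > 0"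
    obtain N :: nat where N: "real N > 2 * (real n * M) / e" using reals_Archimedean2 by blast
    have small: "norm (cmean y k) \<le> \<epsilon> + e / 2" if "k \<ge> N" for k
    proof -
      have "real N \<le> real (Suc k)" using that by simp
      then have "2 * (real n * M) / e \<le> real (Suc k)" using N by linarith
      then have "real n * M / real (Suc k) \<le> e / 2"
        using e by (simp add: field_simps del: of_nat_Suc)
      then show ?thesis using mean[of k] by linarith
    qed
    have "ca (cmean y) \<le> 2 * \<epsilon> + e"
    proof (rule ca_le[where B=M and N=N])
      show "norm (cmean y k) \<le> M" for k using yM by (rule norm_cmean_le)
      fix k l assume "k \<ge> N" "l \<ge> N"
      then show "norm (cmean y k - cmean y l) \<le> 2 * \<epsilon> + e"
        using small[of k] small[of l] norm_triangle_ineq4[of "cmean y k" "cmean y l"] by simp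
    qed
    moreover have "cca x = ca (cmean y)" using cca_diff[of x l] by (simp add: cca_eq_ca_cmean y_def[abs_def])
    ultimately show "cca x \<le> 2 * \<epsilon> + e" by simp
  qed
qed

text \<open>Along no subsequence is \<open>c\<close> an admissible bound, even with
  \<open>2 * n\<close> exceptions allowed. One of the two signs therefore occurs more than
  \<open>n\<close> times, and replacing \<open>f\<close> by \<open>- f\<close> makes it the positive
  one.\<close>

lemma hereditarily_large_of_wu_tilde:
  fixes x :: "nat \<Rightarrow> 'a::real_normed_vector"
  assumes B: "\<And>k. norm (x k) \<le> B" and x: "weakly_conv x l" and c: "0 < c" "c < wu_tilde x l"
  shows "hereditarily_large (\<lambda>k. x k - l) c"
  unfolding hereditarily_large_def
proof (intro allI impI)
  fix r :: "nat \<Rightarrow> nat" and n assume r: "strict_mono r"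
  have "\<not> wu_bound (x \<circ> r) l c"
    using wu_tilde_le[OF B x r] wu_seq_le[of "x \<circ> r" l c] c by auto
  then obtain f where f: "f \<in> dual_ball"
    and big: "\<not> (finite {k. \<bar>f (x (r k) - l)\<bar> > c} \<and> card {k. \<bar>f (x (r k) - l)\<bar> > c} \<le> 2 * n)"
    using c(1) unfolding wu_bound_def o_def by blast
  define P where "P = {k. f (x (r k) - l) > c}"
  define Q where "Q = {k. - f (x (r k) - l) > c}"
  have PQ: "{k. \<bar>f (x (r k) - l)\<bar> > c} = P \<union> Q" using c(1) by (auto simp: P_def Q_def)
  have sub: "\<exists>K\<subseteq>S. finite K \<and> card K = n" if "\<not> (finite S \<and> card S \<le> n)" for S :: "nat set"
    using that infinite_arbitrarily_large[of S n] obtain_subset_with_card_n[of n S]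
    by (metis finite_subset linorder_le_cases)
  have "\<not> (finite P \<and> card P \<le> n) \<or> \<not> (finite Q \<and> card Q \<le> n)"
    using big card_Un_le[of P Q] unfolding PQ by auto
  then show "\<exists>f\<in>dual_ball. \<exists>K. finite K \<and> card K = n \<and> (\<forall>k\<in>K. f (x (r k) - l) > c)"
  proof
    assume "\<not> (finite P \<and> card P \<le> n)"
    then obtain K where "K \<subseteq> P" "finite K" "card K = n" using sub by blast
    then show ?thesis using f by (intro bexI[of _ f] exI[of _ K]) (auto simp: P_def)
  next
    assume "\<not> (finite Q \<and> card Q \<le> n)"
    then obtain K where "K \<subseteq> Q" "finite K" "card K = n" using sub by blast
    moreover have "(\<lambda>z. - f z) \<in> dual_ball"
      using f by (simp add: dual_ball_def bounded_linear_minus onorm_neg)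
    ultimately show ?thesis by (intro bexI[of _ "\<lambda>z. - f z"] exI[of _ K]) (auto simp: Q_def)
  qed
qed

theorem theorem4p1:
  fixes A :: "'a::banach set"
  assumes "bounded A"
  shows "sm A \<le> wbs A / 2 \<and> wbs A / 2 \<le> wu A \<and> wu A \<le> 2 * sm A"
proof -
  obtain B where B: "\<And>a. a \<in> A \<Longrightarrow> norm a \<le> B" using assms by (auto simp: bounded_iff)
  define S where "S = {\<delta>. \<delta> > 0 \<and> (\<exists>x l. range x \<subseteq> A \<and> weakly_conv x l \<and> l1_spreading (\<lambda>k. x k - l) \<delta>)}"
  have S: "\<delta> \<le> wbs A / 2" if "\<delta> \<in> S" for \<delta>
  proof -
    from that obtain x l where "\<delta> > 0" "range x \<subseteq> A" "weakly_conv x l" "l1_spreading (\<lambda>k. x k - l) \<delta>"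
      by (auto simp: S_def)
    then show ?thesis using l1_spreading_le_wbs[of A B x l \<delta>] B by simp
  qed
  \<comment> \<open>A real supremum dominates the inserted 0 only if the set is bounded above, so
    boundedness precedes nonnegativity.\<close>
  have "bdd_above (insert 0 {cca_tilde x |x. range x \<subseteq> A \<and> (\<exists>l. weakly_conv x l)})"
  proof (rule bdd_aboveI)
    fix t assume "t \<in> insert 0 {cca_tilde x |x. range x \<subseteq> A \<and> (\<exists>l. weakly_conv x l)}"
    then show "t \<le> max 0 (wbs A)" using cca_tilde_le_wbs[OF B] by fastforce
  qed
  then have wbs0: "0 \<le> wbs A" unfolding wbs_def by (intro cSup_upper) auto
  have bddS: "bdd_above (insert 0 S)" using S wbs0 by (intro bdd_aboveI[of _ "wbs A / 2"]) auto
  have sm: "sm A = Sup (insert 0 S)" by (simp add: sm_def S_def)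
  have sm0: "0 \<le> sm A" unfolding sm using bddS by (intro cSup_upper) auto
  have "bdd_above (insert 0 {wu_tilde x l |x l. range x \<subseteq> A \<and> weakly_conv x l})"
  proof (rule bdd_aboveI)
    fix t assume "t \<in> insert 0 {wu_tilde x l |x l. range x \<subseteq> A \<and> weakly_conv x l}"
    then show "t \<le> max 0 (wu A)" using wu_tilde_le_wu[OF B] by fastforce
  qed
  then have wu0: "0 \<le> wu A" unfolding wu_def by (intro cSup_upper) auto
  have "sm A \<le> wbs A / 2" unfolding sm using S wbs0 by (intro cSup_least) auto
  moreover have "wbs A \<le> 2 * wu A"
  proof (rule wbs_le)
    fix x l assume x: "range x \<subseteq> A" "weakly_conv x l"
    have xB: "norm (x k) \<le> B" for k using B x by blast
    have "cca_tilde x / 2 \<le> wu_tilde x l"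
    proof (rule le_wu_tilde[OF xB x(2)])
      fix r :: "nat \<Rightarrow> nat" and \<epsilon> assume "strict_mono r" "wu_bound (x \<circ> r) l \<epsilon>"
      then show "cca_tilde x / 2 \<le> \<epsilon>"
        using cca_tilde_le[of x B r] cca_le_wu_bound[of "x \<circ> r" B l \<epsilon>] xB by simp
    qed
    then show "cca_tilde x \<le> 2 * wu A" using wu_tilde_le_wu[OF B x] by simp
  qed (use wu0 in simp)
  moreover have "wu A \<le> 2 * sm A"
  proof (rule wu_le)
    fix x l assume x: "range x \<subseteq> A" "weakly_conv x l"
    have xB: "norm (x k) \<le> B" for k using B x by blast
    show "wu_tilde x l \<le> 2 * sm A"
    proof (rule ccontr)
      assume "\<not> ?thesis"
      \<comment> \<open>Extraction loses an arbitrarily small amount below \<open>c / 2\<close>, so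
        \<open>c\<close> and \<open>\<delta>\<close> are both placed strictly inside the assumed
        gap; the resulting \<open>\<delta> \<in> S\<close> then exceeds the supremum of
        \<open>S\<close>.\<close>
      then obtain c where c: "2 * sm A < c" "c < wu_tilde x l" using dense not_le by metis
      then obtain \<delta> where \<delta>: "sm A < \<delta>" "\<delta> < c / 2" using dense[of "sm A" "c / 2"] by auto
      have c0: "c > 0" and \<delta>0: "\<delta> > 0" using c \<delta> sm0 by auto
      have yB: "norm (x k - l) \<le> B + norm l" for k
        using xB by (rule order_trans[OF norm_triangle_ineq4 add_right_mono])
      obtain r where r: "strict_mono r" "l1_spreading ((\<lambda>k. x k - l) \<circ> r) \<delta>"
        using exists_l1_spreading_subseq[OF weakly_conv_diff[OF x(2)]
            hereditarily_large_of_wu_tilde[OF xB x(2) c0 c(2)] yB c0 \<delta>(2)] by blast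
      have "\<delta> \<in> S"
        using r \<delta>0 x weakly_conv_subseq[OF x(2) r(1)] unfolding S_def
        by (auto simp: o_def intro!: exI[of _ "x \<circ> r"] exI[of _ l])
      then have "\<delta> \<le> sm A" unfolding sm using bddS by (intro cSup_upper) auto
      then show False using \<delta>(1) by simp
    qed
  qed (use sm0 in simp)
  ultimately show ?thesis by simp
qed

end
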